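(* Let $\mathbf{Q}(t)=(Q_1(t),\ldots,Q_K(t))$, $t\in\{0,1,2,\ldots\}$, be a stochastic vector process with real-valued components and let $p(t)$ be a real-valued stochastic process on the same probability space. Let $\mathcal{H}(0)=\{\mathbf{Q}(0)\}$ and, for $t>0$, $\mathcal{H}(t)=\{\mathbf{Q}(0),\ldots,\mathbf{Q}(t),p(0),\ldots,p(t-1)\}$. Let $L(\mathbf{Q})=\frac{1}{2}\sum_{k=1}^K w_kQ_k^2$ with constants $w_k>0$, and $\Delta(\mathcal{H}(t))=\mathbb{E}[L(\mathbf{Q}(t+1))-L(\mathbf{Q}(t))\mid \mathcal{H}(t)]$. Assume: (i) $\mathbb{E}[p(t)^2]<\infty$ for all $t$ and $\sum_{\tau=1}^\infty \mathbb{E}[p(\tau)^2]/\tau^2<\infty$; (ii) there is a finite (possibly negative) constant $p_{min}$ with $\mathbb{E}[p(t)\mid\mathcal{H}(t)]\geq p_{min}$ for all $t$ and all possible $\mathcal{H}(t)$; (iii) there is a finite constant $D>0$ with $\mathbb{E}[(Q_k(t+1)-Q_k(t))^4\mid \mathbf{Q}(t)]\leq D$ for all $t$, all possible $\mathbf{Q}(t)$ and all $k\in\{1,\ldots,K\}$; (iv) $\mathbf{Q}(0)$ is finite with probability 1; (v) there are finite constants $B$, $p^*$, $V>0$, $\epsilon>0$ such that for all $t$ and all possible $\mathcal{H}(t)$, $$\Delta(\mathcal{H}(t))+V\,\mathbb{E}[p(t)\mid\mathcal{H}(t)]\leq B+Vp^*-\epsilon\sum_{k=1}^K|Q_k(t)|.$$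 Then with probability 1, $$\limsup_{t\to\infty}\frac{1}{t}\sum_{\tau=0}^{t-1}p(\tau)\leq p^*+\frac{B}{V},\qquad \limsup_{t\to\infty}\frac{1}{t}\sum_{\tau=0}^{t-1}\sum_{k=1}^K|Q_k(\tau)|\leq \frac{B+V(p^*-p_{min})}{\epsilon},$$ and for every $k\in\{1,\ldots,K\}$, $\lim_{t\to\infty}Q_k(t)/t=0$ with probability 1. Finally, if the inequality in (v) holds with $V=0$ (and the other assumptions hold), then the second bound above (with $V=0$) and $\lim_{t\to\infty}Q_k(t)/t=0$ w.p.1 for all $k$ still hold.
   Context: Time is slotted, $t\in\{0,1,2,\ldots\}$. "For all possible $\mathcal{H}(t)$" means for every realization of the history (i.e., almost surely). The conditional expectation $\mathbb{E}[\cdot\mid\mathcal{H}(t)]$ is with respect to the information $\mathbf{Q}(0),\ldots,\mathbf{Q}(t),p(0),\ldots,p(t-1)$. *)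

theory Defs
  imports "HOL-Probability.Probability"
begin

definition hist ::
  "'a measure \<Rightarrow> (nat \<Rightarrow> nat \<Rightarrow> 'a \<Rightarrow> real) \<Rightarrow> (nat \<Rightarrow> 'a \<Rightarrow> real) \<Rightarrow> nat \<Rightarrow> nat \<Rightarrow> 'a measure" where
  "hist M Q p K t = sigma (space M)
     ({Q s k -` B \<inter> space M | s k B. s \<le> t \<and> k \<in> {1..K} \<and> B \<in> sets borel} \<union>
      {p s -` B \<inter> space M | s B. s < t \<and> B \<in> sets borel})"

definition qsig ::
  "'a measure \<Rightarrow> (nat \<Rightarrow> nat \<Rightarrow> 'a \<Rightarrow> real) \<Rightarrow> nat \<Rightarrow> nat \<Rightarrow> 'a measure" where
  "qsig M Q K t = sigma (space M)
     {Q t k -` B \<inter> space M | k B. k \<in> {1..K} \<and> B \<in> sets borel}"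

definition lyap :: "(nat \<Rightarrow> real) \<Rightarrow> nat \<Rightarrow> (nat \<Rightarrow> real) \<Rightarrow> real" where
  "lyap w K q = (1/2) * (\<Sum>k\<in>{1..K}. w k * (q k)^2)"

end

theory Submission
  imports Defs "HOL-Real_Asymp.Real_Asymp"
begin

text \<open>Since the Lyapunov function \<open>L\<close> is nonnegative, both time average bounds follow by summing the
  drift inequality, once the increments of \<open>L\<close> and the penalties \<open>p\<close> satisfy a strong law of large
  numbers relative to their conditional expectations. The increments of \<open>L\<close> may have variance of order
  \<open>t\<close>, which just fails the variance condition of that law, so they are truncated. On
  \<open>{L 0 \<le> N}\<close> the process \<open>L t / (t + 1) powr (8/7)\<close> is an almost supermartingale and tends to 0;
  hence it suffices to treat the increments on \<open>{L t \<le> (t + 1) powr (8/7)}\<close>. There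
  \<open>h\<^sup>2 S\<^sup>2\<close>, with \<open>h\<close> the \<open>\<ell>\<^sup>1\<close> norm of the queue vector and \<open>S\<close> that of its
  increment, is bounded by weighted multiples of \<open>h\<close> and \<open>S ^ 4\<close>; the former are summable in mean by
  the drift inequality itself, the latter by the fourth moment bound. Only the unconditional fourth moments
  enter, because \<open>{L 0 \<le> N}\<close> need not be measurable with respect to the current queue vector.\<close>

section \<open>Almost supermartingales and the strong law for martingale differences\<close>

locale filtered_prob_space = prob_space M for M :: "'a measure" +
  fixes F :: "nat \<Rightarrow> 'a measure"
  assumes subalgebra_filtration: "subalgebra M (F t)"
    and filtration_mono: "s \<le> t \<Longrightarrow> subalgebra (F t) (F s)"
begin

lemma sigma_finite_subalgebra_filtration: "sigma_finite_subalgebra M (F t)"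
proof -
  interpret finite_measure_subalgebra M "F t"
    by unfold_locales (rule subalgebra_filtration)
  show ?thesis ..
qed

lemma measurable_filtration_mono:
  "f \<in> borel_measurable (F s) \<Longrightarrow> s \<le> t \<Longrightarrow> f \<in> borel_measurable (F t)"
  using filtration_mono measurable_from_subalg by blast

lemma measurable_filtration: "f \<in> borel_measurable (F t) \<Longrightarrow> f \<in> borel_measurable M"
  using subalgebra_filtration measurable_from_subalg by blast

lemma sets_filtration: "A \<in> sets (F t) \<Longrightarrow> A \<in> sets M"
  using subalgebra_filtration unfolding subalgebra_def by blast

lemma space_filtration: "space (F t) = space M"
  using subalgebra_filtration unfolding subalgebra_def by blast

text \<open>Stop at the first time from \<open>m\<close> on at which \<open>Y\<close> exceeds
  \<open>c\<close>. \<open>J n\<close> is the event that this has not happened by time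
  \<open>m+n\<close>, and \<open>U n\<close> is the process with its value frozen at
  \<open>c\<close> afterwards. Since \<open>J n\<close> lies in \<open>F (m+n)\<close>, the step
  inequality applies on it and raises the mean of \<open>U\<close> by at most
  \<open>e (m+n)\<close>; off \<open>J n\<close> the value of \<open>U n\<close> is
  \<open>c\<close>, which yields the probability.\<close>

lemma almost_supermartingale_maximal:
  fixes Y :: "nat \<Rightarrow> 'a \<Rightarrow> real"
  assumes Y_meas: "\<And>t. Y t \<in> borel_measurable (F t)"
    and Y_int: "\<And>t. integrable M (Y t)"
    and Y_nonneg: "\<And>t \<omega>. Y t \<omega> \<ge> 0"
    and step: "\<And>t A. A \<in> sets (F t) \<Longrightarrow>
      (\<integral>\<omega>. indicator A \<omega> * Y (Suc t) \<omega> \<partial>M) \<le> (\<integral>\<omega>. indicator A \<omega> * Y t \<omega> \<partial>M) + e t"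
    and c: "c \<ge> 0"
  shows "c * prob {\<omega>\<in>space M. \<exists>s\<in>{m..m+n}. Y s \<omega> > c} \<le> (\<integral>\<omega>. Y m \<omega> \<partial>M) + (\<Sum>s<n. e (m + s))"
proof -
  define J where "J n = {\<omega>\<in>space M. \<forall>s\<in>{m..m+n}. Y s \<omega> \<le> c}" for n
  define U where "U n \<omega> = indicator (J n) \<omega> * Y (m+n) \<omega> + c * (1 - indicator (J n) \<omega>)" for n \<omega>
  have J_sets: "J n \<in> sets (F (m+n))" for n
  proof -
    have "Y s \<in> borel_measurable (F (m+n))" if "s \<in> {m..m+n}" for s
      using that by (intro measurable_filtration_mono[OF Y_meas]) auto
    then have "{\<omega>\<in>space (F (m+n)). \<forall>s\<in>{m..m+n}. Y s \<omega> \<le> c} \<in> sets (F (m+n))"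
      by (intro sets.sets_Collect_finite_All' borel_measurable_le) auto
    then show ?thesis by (simp add: J_def space_filtration)
  qed
  have [measurable]: "J n \<in> sets M" for n using J_sets sets_filtration by blast
  have intJ: "integrable M (\<lambda>\<omega>. indicator (J k) \<omega> * Y l \<omega>)" for k l
    using integrable_mult_indicator[OF _ Y_int[of l], of "J k"] by simp
  have intI: "integrable M (\<lambda>\<omega>. c * (1 - indicator (J k) \<omega>))" for k by (auto simp: emeasure_eq_measure)
  have intU: "integrable M (U k)" for k unfolding U_def using intJ intI by auto
  have main: "(\<integral>\<omega>. U n \<omega> \<partial>M) \<le> (\<integral>\<omega>. Y m \<omega> \<partial>M) + (\<Sum>s<n. e (m + s))" for n
  proof (induction n)
    case 0
    have "(\<integral>\<omega>. U 0 \<omega> \<partial>M) \<le> (\<integral>\<omega>. Y m \<omega> \<partial>M)"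
      by (intro integral_mono intU Y_int) (auto simp: U_def J_def indicator_def)
    then show ?case by simp
  next
    case (Suc n)
    have "(\<integral>\<omega>. U (Suc n) \<omega> \<partial>M) \<le> (\<integral>\<omega>. indicator (J n) \<omega> * Y (Suc (m+n)) \<omega> + c * (1 - indicator (J n) \<omega>) \<partial>M)"
    proof (intro integral_mono intU Bochner_Integration.integrable_add intJ intI)
      fix \<omega> assume "\<omega> \<in> space M"
      \<comment> \<open>A path that leaves \<open>J n\<close> in this step has \<open>Y\<close>
        above \<open>c\<close>, so freezing it at \<open>c\<close> only lowers the value.\<close>
      have "J (Suc n) = J n \<inter> {\<omega>\<in>space M. Y (Suc (m+n)) \<omega> \<le> c}"
        by (auto simp: J_def le_Suc_eq)
      with \<open>\<omega> \<in> space M\<close> show "U (Suc n) \<omega> \<le> indicator (J n) \<omega> * Y (Suc (m+n)) \<omega> + c * (1 - indicator (J n) \<omega>)"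
        by (auto simp: U_def indicator_def)
    qed
    also have "\<dots> = (\<integral>\<omega>. indicator (J n) \<omega> * Y (Suc (m+n)) \<omega> \<partial>M) + (\<integral>\<omega>. c * (1 - indicator (J n) \<omega>) \<partial>M)"
      by (intro Bochner_Integration.integral_add intJ intI)
    also have "\<dots> \<le> (\<integral>\<omega>. indicator (J n) \<omega> * Y (m+n) \<omega> \<partial>M) + e (m+n) + (\<integral>\<omega>. c * (1 - indicator (J n) \<omega>) \<partial>M)"
      using step[OF J_sets[of n]] by simp
    also have "\<dots> = (\<integral>\<omega>. U n \<omega> \<partial>M) + e (m+n)"
      unfolding U_def by (subst Bochner_Integration.integral_add[OF intJ intI]) simp
    finally show ?case using Suc by simp
  qed
  have "{\<omega>\<in>space M. \<exists>s\<in>{m..m+n}. Y s \<omega> > c} = space M - J n" by (auto simp: J_def not_le)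
  then have "c * prob {\<omega>\<in>space M. \<exists>s\<in>{m..m+n}. Y s \<omega> > c} = c * (1 - prob (J n))"
    by (simp add: prob_compl)
  also have "\<dots> = (\<integral>\<omega>. c * (1 - indicator (J n) \<omega>) \<partial>M)"
    by (simp add: prob_space emeasure_eq_measure)
  also have "\<dots> \<le> (\<integral>\<omega>. U n \<omega> \<partial>M)"
    by (intro integral_mono intU intI) (auto simp: U_def Y_nonneg)
  finally show ?thesis using main[of n] by linarith
qed

text \<open>By the maximal inequality, exceeding \<open>c\<close> at some time from \<open>m\<close>
  on has probability at most \<open>r m / c\<close>, where \<open>r m\<close> is the mean of
  \<open>Y m\<close> plus the tail of the error series. As \<open>r m\<close> tends to 0, exceeding
  \<open>c\<close> infinitely often is a null event; countably many levels
  \<open>1 / real (Suc n)\<close> suffice.\<close>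

lemma almost_supermartingale_tendsto_0:
  fixes Y :: "nat \<Rightarrow> 'a \<Rightarrow> real"
  assumes Y_meas: "\<And>t. Y t \<in> borel_measurable (F t)"
    and Y_int: "\<And>t. integrable M (Y t)"
    and Y_nonneg: "\<And>t \<omega>. Y t \<omega> \<ge> 0"
    and step: "\<And>t A. A \<in> sets (F t) \<Longrightarrow>
      (\<integral>\<omega>. indicator A \<omega> * Y (Suc t) \<omega> \<partial>M) \<le> (\<integral>\<omega>. indicator A \<omega> * Y t \<omega> \<partial>M) + e t"
    and e_nonneg: "\<And>t. e t \<ge> 0"
    and e_summable: "summable e"
    and Y_lim: "(\<lambda>t. \<integral>\<omega>. Y t \<omega> \<partial>M) \<longlonglongrightarrow> 0"
  shows "AE \<omega> in M. (\<lambda>t. Y t \<omega>) \<longlonglongrightarrow> 0"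
proof -
  have [measurable]: "Y t \<in> borel_measurable M" for t using Y_meas measurable_filtration by blast
  define r where "r m = (\<integral>\<omega>. Y m \<omega> \<partial>M) + (\<Sum>s. e (s + m))" for m
  have "r \<longlonglongrightarrow> 0 + 0"
    unfolding r_def by (intro tendsto_add Y_lim suminf_exist_split2 e_summable)
  then have r_lim: "r \<longlonglongrightarrow> 0" by simp
  have ev: "AE \<omega> in M. \<exists>m. \<forall>s\<ge>m. Y s \<omega> \<le> c" if c: "c > 0" for c
  proof -
    define G where "G m n = {\<omega>\<in>space M. \<exists>s\<in>{m..m+n}. Y s \<omega> > c}" for m n
    define G' where "G' m = {\<omega>\<in>space M. \<exists>s\<ge>m. Y s \<omega> > c}" for m
    have [measurable]: "G m n \<in> sets M" "G' m \<in> sets M" for m n unfolding G_def G'_def by measurable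
    have "prob (G m n) \<le> r m / c" for m n
    proof -
      have "c * prob (G m n) \<le> (\<integral>\<omega>. Y m \<omega> \<partial>M) + (\<Sum>s<n. e (m + s))"
        unfolding G_def using c by (intro almost_supermartingale_maximal assms) auto
      also have "(\<Sum>s<n. e (m + s)) \<le> (\<Sum>s. e (s + m))"
        using e_nonneg e_summable by (subst add.commute, intro sum_le_suminf) (auto simp: summable_iff_shift)
      finally show ?thesis using c by (simp add: r_def field_simps)
    qed
    \<comment> \<open>The bound is uniform in the window length \<open>n\<close>, so continuity from
      below carries it over to the infinite horizon.\<close>
    moreover have "(\<lambda>n. prob (G m n)) \<longlonglongrightarrow> prob (G' m)" for m
    proof -
      have "(\<Union>n. G m n) = G' m"
        unfolding G_def G'_def by (auto, metis atLeastAtMost_iff le_add_diff_inverse order_refl)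
      moreover have "(\<lambda>n. prob (G m n)) \<longlonglongrightarrow> prob (\<Union>n. G m n)"
      proof (rule finite_Lim_measure_incseq)
        show "range (G m) \<subseteq> sets M" by auto
        show "incseq (G m)" by (force simp: incseq_def G_def)
      qed
      ultimately show ?thesis by simp
    qed
    ultimately have G'_le: "prob (G' m) \<le> r m / c" for m
      by (meson LIMSEQ_le_const2)
    define N where "N = (\<Inter>m. G' m)"
    have [measurable]: "N \<in> sets M" unfolding N_def by measurable
    have "prob N \<le> r m / c" for m
    proof -
      have "prob N \<le> prob (G' m)" by (intro finite_measure_mono) (auto simp: N_def)
      with G'_le[of m] show ?thesis by linarith
    qed
    moreover have "(\<lambda>m. r m / c) \<longlonglongrightarrow> 0" using tendsto_divide[OF r_lim tendsto_const, of c] c by simp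
    ultimately have "prob N \<le> 0" by (meson LIMSEQ_le_const)
    then have "N \<in> null_sets M" by (simp add: null_sets_def emeasure_eq_measure measure_le_0_iff)
    then have "AE \<omega> in M. \<omega> \<notin> N" by (rule AE_not_in)
    with AE_space show ?thesis
    proof eventually_elim
      case (elim \<omega>)
      then obtain m where "\<omega> \<notin> G' m" by (auto simp: N_def)
      with elim(1) show ?case unfolding G'_def by (auto simp: not_less)
    qed
  qed
  have "AE \<omega> in M. \<forall>n. \<exists>m. \<forall>s\<ge>m. Y s \<omega> \<le> 1 / real (Suc n)"
    by (subst AE_all_countable, intro allI ev) simp
  then show ?thesis
  proof eventually_elim
    case (elim \<omega>)
    show ?case
    proof (rule LIMSEQ_I)
      fix c :: real assume "c > 0"
      then obtain n where n: "1 / real (Suc n) < c" using nat_approx_posE by (metis of_nat_Suc)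
      from elim obtain m where "\<forall>s\<ge>m. Y s \<omega> \<le> 1 / real (Suc n)" by blast
      with n show "\<exists>m. \<forall>s\<ge>m. norm (Y s \<omega> - 0) < c"
        by (intro exI[of _ m]) (auto simp: Y_nonneg intro: le_less_trans)
    qed
  qed
qed

end

text \<open>For nonnegative terms Kronecker's lemma is dominated convergence for series:
  \<open>a k n\<close> tends to 0 for fixed \<open>k\<close>, and \<open>k < n\<close> gives
  \<open>Suc k \<le> n\<close>, so the summable \<open>v k / (real (Suc k))\<^sup>2\<close>
  dominates it.\<close>

lemma kronecker_nonneg:
  fixes v :: "nat \<Rightarrow> real"
  assumes v_nonneg: "\<And>s. v s \<ge> 0"
    and v_summable: "summable (\<lambda>s. v s / (real (Suc s))\<^sup>2)"
  shows "(\<lambda>n. (\<Sum>s<n. v s) / (real n)\<^sup>2) \<longlonglongrightarrow> 0"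
proof -
  define a where "a k n = (if k < n then v k / (real n)\<^sup>2 else 0)" for k n
  have bound: "norm (a k n) \<le> v k / (real (Suc k))\<^sup>2" for k n
    using v_nonneg[of k] by (auto simp: a_def intro!: divide_left_mono power_mono mult_pos_pos)
  have lim: "(\<lambda>n. a k n) \<longlonglongrightarrow> 0" for k
  proof (rule Lim_null_comparison)
    show "\<forall>\<^sub>F n in sequentially. norm (a k n) \<le> v k / (real n)\<^sup>2"
      using v_nonneg[of k] by (auto simp: a_def intro!: always_eventually)
    show "(\<lambda>n. v k / (real n)\<^sup>2) \<longlonglongrightarrow> 0"
      by real_asymp
  qed
  have "(\<lambda>n. suminf (\<lambda>k. a k n)) \<longlonglongrightarrow> suminf (\<lambda>k. 0)"
    using tannerys_theorem[of a "\<lambda>_. 0" sequentially, OF lim _ v_summable] bound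
    by (simp add: always_eventually split_beta)
  moreover have "suminf (\<lambda>k. a k n) = (\<Sum>s<n. v s) / (real n)\<^sup>2" for n
  proof -
    have "suminf (\<lambda>k. a k n) = (\<Sum>k<n. a k n)"
      by (intro suminf_finite) (auto simp: a_def)
    then show ?thesis by (simp add: a_def sum_divide_distrib)
  qed
  ultimately show ?thesis by simp
qed

section \<open>Square-integrable martingale differences\<close>

lemma integrable_mult_of_squares:
  fixes f g :: "'a \<Rightarrow> real"
  assumes [measurable]: "f \<in> borel_measurable M" "g \<in> borel_measurable M"
    and "integrable M (\<lambda>x. (f x)\<^sup>2)" "integrable M (\<lambda>x. (g x)\<^sup>2)"
  shows "integrable M (\<lambda>x. f x * g x)"
proof (rule Bochner_Integration.integrable_bound)
  show "integrable M (\<lambda>x. (f x)\<^sup>2 + (g x)\<^sup>2)" using assms by auto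
  show "AE x in M. norm (f x * g x) \<le> norm ((f x)\<^sup>2 + (g x)\<^sup>2)"
  proof (rule AE_I2)
    fix x
    have "2 * (\<bar>f x\<bar> * \<bar>g x\<bar>) \<le> (f x)\<^sup>2 + (g x)\<^sup>2"
      using sum_squares_bound[of "\<bar>f x\<bar>" "\<bar>g x\<bar>"] by simp
    moreover have "0 \<le> \<bar>f x\<bar> * \<bar>g x\<bar>" by simp
    ultimately have "\<bar>f x\<bar> * \<bar>g x\<bar> \<le> (f x)\<^sup>2 + (g x)\<^sup>2" by linarith
    then show "norm (f x * g x) \<le> norm ((f x)\<^sup>2 + (g x)\<^sup>2)" by (simp add: abs_mult)
  qed
qed measurable

context filtered_prob_space
begin

text \<open>Conditional Jensen for the square makes conditioning a contraction of second moments. In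
  the strong law this transfers the variance bounds from \<open>X t\<close> to the centred
  differences.\<close>

lemma cond_exp_square:
  fixes X :: "'a \<Rightarrow> real"
  assumes X[measurable]: "X \<in> borel_measurable M" and X_sq: "integrable M (\<lambda>\<omega>. (X \<omega>)\<^sup>2)"
  shows "integrable M (\<lambda>\<omega>. (real_cond_exp M (F t) X \<omega>)\<^sup>2)"
    and "(\<integral>\<omega>. (real_cond_exp M (F t) X \<omega>)\<^sup>2 \<partial>M) \<le> (\<integral>\<omega>. (X \<omega>)\<^sup>2 \<partial>M)"
proof -
  interpret sigma_finite_subalgebra M "F t" by (rule sigma_finite_subalgebra_filtration)
  have X_int: "integrable M X" using X_sq X square_integrable_imp_integrable by blast
  have le: "AE \<omega> in M. (real_cond_exp M (F t) X \<omega>)\<^sup>2 \<le> real_cond_exp M (F t) (\<lambda>\<omega>. (X \<omega>)\<^sup>2) \<omega>"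
    by (rule real_cond_exp_jensens_inequality(2)[of X UNIV]) (use X_int X_sq convex_power2 in auto)
  have int: "integrable M (real_cond_exp M (F t) (\<lambda>\<omega>. (X \<omega>)\<^sup>2))"
    using X_sq by (rule real_cond_exp_int(1))
  show *: "integrable M (\<lambda>\<omega>. (real_cond_exp M (F t) X \<omega>)\<^sup>2)"
    by (rule Bochner_Integration.integrable_bound[OF int]) (use le in auto)
  have "(\<integral>\<omega>. (real_cond_exp M (F t) X \<omega>)\<^sup>2 \<partial>M) \<le> (\<integral>\<omega>. real_cond_exp M (F t) (\<lambda>\<omega>. (X \<omega>)\<^sup>2) \<omega> \<partial>M)"
    by (intro integral_mono_AE * int le)
  also have "\<dots> = (\<integral>\<omega>. (X \<omega>)\<^sup>2 \<partial>M)" using X_sq by (rule real_cond_exp_int(2))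
  finally show "(\<integral>\<omega>. (real_cond_exp M (F t) X \<omega>)\<^sup>2 \<partial>M) \<le> (\<integral>\<omega>. (X \<omega>)\<^sup>2 \<partial>M)" .
qed

text \<open>The centred differences \<open>Z\<close> are orthogonal to the past, so on an event of
  \<open>F n\<close> the integral of \<open>(S n \<omega>)\<^sup>2\<close> grows by exactly that of
  \<open>(Z n \<omega>)\<^sup>2\<close>. Hence the squared average \<open>Y n\<close> is an almost
  supermartingale with error \<open>v n / (real (Suc n))\<^sup>2\<close>, and its mean vanishes by
  Kronecker's lemma.\<close>

lemma martingale_difference_SLLN:
  fixes X :: "nat \<Rightarrow> 'a \<Rightarrow> real"
  assumes X_meas: "\<And>t. X t \<in> borel_measurable (F (Suc t))"
    and X_sq: "\<And>t. integrable M (\<lambda>\<omega>. (X t \<omega>)\<^sup>2)"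
    and X_sum: "summable (\<lambda>t. (\<integral>\<omega>. (X t \<omega>)\<^sup>2 \<partial>M) / (real (Suc t))\<^sup>2)"
  shows "AE \<omega> in M. (\<lambda>n. (\<Sum>t<n. X t \<omega> - real_cond_exp M (F t) (X t) \<omega>) / real n) \<longlonglongrightarrow> 0"
proof -
  have [measurable]: "X t \<in> borel_measurable M" for t using X_meas measurable_filtration by blast
  have X_int: "integrable M (X t)" for t using square_integrable_imp_integrable[OF _ X_sq] by simp
  define E where "E t = real_cond_exp M (F t) (X t)" for t
  define Z where "Z t \<omega> = X t \<omega> - E t \<omega>" for t \<omega>
  define S where "S n \<omega> = (\<Sum>t<n. Z t \<omega>)" for n \<omega>
  define Y where "Y n \<omega> = (S n \<omega> / real n)\<^sup>2" for n \<omega>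
  define v where "v t = (\<integral>\<omega>. (Z t \<omega>)\<^sup>2 \<partial>M)" for t
  have E_meas: "E t \<in> borel_measurable (F t)" for t unfolding E_def by simp
  have [measurable]: "E t \<in> borel_measurable M" for t unfolding E_def by simp
  have [measurable]: "Z t \<in> borel_measurable M" for t unfolding Z_def by simp
  have [measurable]: "S t \<in> borel_measurable M" for t unfolding S_def by simp
  have Z_meas: "Z t \<in> borel_measurable (F (Suc t))" for t
    unfolding Z_def using measurable_filtration_mono[OF E_meas, of t "Suc t"] X_meas[of t] by auto
  have S_meas: "S n \<in> borel_measurable (F n)" for n
    unfolding S_def by (intro borel_measurable_sum measurable_filtration_mono[OF Z_meas]) auto
  have E_sq: "integrable M (\<lambda>\<omega>. (E t \<omega>)\<^sup>2)" "(\<integral>\<omega>. (E t \<omega>)\<^sup>2 \<partial>M) \<le> (\<integral>\<omega>. (X t \<omega>)\<^sup>2 \<partial>M)" for t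
    unfolding E_def by (intro cond_exp_square X_sq; simp)+
  have Z_le: "(Z t \<omega>)\<^sup>2 \<le> 2 * (X t \<omega>)\<^sup>2 + 2 * (E t \<omega>)\<^sup>2" for t \<omega>
    using zero_le_power2[of "X t \<omega> + E t \<omega>"] unfolding Z_def by (simp add: power2_eq_square algebra_simps)
  have Z_sq: "integrable M (\<lambda>\<omega>. (Z t \<omega>)\<^sup>2)" for t
    by (rule Bochner_Integration.integrable_bound[of _ "\<lambda>\<omega>. 2 * (X t \<omega>)\<^sup>2 + 2 * (E t \<omega>)\<^sup>2"])
      (use X_sq E_sq Z_le in auto)
  have v_le: "v t \<le> 4 * (\<integral>\<omega>. (X t \<omega>)\<^sup>2 \<partial>M)" for t
  proof -
    have "v t \<le> (\<integral>\<omega>. 2 * (X t \<omega>)\<^sup>2 + 2 * (E t \<omega>)\<^sup>2 \<partial>M)"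
      unfolding v_def by (intro integral_mono Z_sq Z_le) (use X_sq E_sq in auto)
    also have "\<dots> = 2 * (\<integral>\<omega>. (X t \<omega>)\<^sup>2 \<partial>M) + 2 * (\<integral>\<omega>. (E t \<omega>)\<^sup>2 \<partial>M)"
      using X_sq E_sq by simp
    finally show ?thesis using E_sq(2)[of t] by linarith
  qed
  have v_nonneg: "v t \<ge> 0" for t unfolding v_def by simp
  have v_sum: "summable (\<lambda>t. v t / (real (Suc t))\<^sup>2)"
  proof (rule summable_comparison_test'[of _ 0])
    show "summable (\<lambda>t. 4 * ((\<integral>\<omega>. (X t \<omega>)\<^sup>2 \<partial>M) / (real (Suc t))\<^sup>2))"
      by (intro summable_mult X_sum)
    show "norm (v t / (real (Suc t))\<^sup>2) \<le> 4 * ((\<integral>\<omega>. (X t \<omega>)\<^sup>2 \<partial>M) / (real (Suc t))\<^sup>2)" for t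
      using v_le[of t] v_nonneg[of t] by (simp add: divide_right_mono)
  qed
  have S_Suc: "(S (Suc n) \<omega>)\<^sup>2 = (S n \<omega>)\<^sup>2 + 2 * (S n \<omega> * Z n \<omega>) + (Z n \<omega>)\<^sup>2" for n \<omega>
    by (simp add: S_def power2_eq_square algebra_simps)
  have S_sq: "integrable M (\<lambda>\<omega>. (S n \<omega>)\<^sup>2)" for n
  proof (induction n)
    case 0
    then show ?case by (simp add: S_def)
  next
    case (Suc n)
    then show ?case unfolding S_Suc
      by (intro Bochner_Integration.integrable_add integrable_mult_right integrable_mult_of_squares Z_sq) auto
  qed
  have ind_int: "integrable M (\<lambda>\<omega>. indicator A \<omega> * f \<omega>)" if "A \<in> sets M" "integrable M f" for A and f :: "'a \<Rightarrow> real"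
    using integrable_mult_indicator[OF that] by simp
  have SZ_int: "integrable M (\<lambda>\<omega>. S n \<omega> * Z n \<omega>)" for n
    by (intro integrable_mult_of_squares S_sq Z_sq) auto
  \<comment> \<open>The factor \<open>indicator A \<omega> * S n \<omega>\<close> is known at time
    \<open>n\<close>, so under the integral \<open>X n\<close> may be replaced by its conditional
    expectation \<open>E n\<close>.\<close>
  have orth: "(\<integral>\<omega>. indicator A \<omega> * (S n \<omega> * Z n \<omega>) \<partial>M) = 0" if A: "A \<in> sets (F n)" for A n
  proof -
    interpret sigma_finite_subalgebra M "F n" by (rule sigma_finite_subalgebra_filtration)
    have AM: "A \<in> sets M" using A sets_filtration by blast
    have int1: "integrable M (\<lambda>\<omega>. (indicator A \<omega> * S n \<omega>) * X n \<omega>)"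
      using ind_int[OF AM integrable_mult_of_squares[OF _ _ S_sq X_sq, of n n]] by (simp add: mult.assoc)
    have m: "(\<lambda>\<omega>. indicator A \<omega> * S n \<omega>) \<in> borel_measurable (F n)"
      using A S_meas[of n] by auto
    note * = real_cond_exp_intg[OF int1 m, folded E_def]
    have "(\<integral>\<omega>. indicator A \<omega> * (S n \<omega> * Z n \<omega>) \<partial>M) =
        (\<integral>\<omega>. (indicator A \<omega> * S n \<omega>) * X n \<omega> - (indicator A \<omega> * S n \<omega>) * E n \<omega> \<partial>M)"
      by (simp add: Z_def algebra_simps)
    also have "\<dots> = 0" using int1 * by simp
    finally show ?thesis .
  qed
  have S2_Suc: "(\<integral>\<omega>. indicator A \<omega> * (S (Suc n) \<omega>)\<^sup>2 \<partial>M) =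
      (\<integral>\<omega>. indicator A \<omega> * (S n \<omega>)\<^sup>2 \<partial>M) + (\<integral>\<omega>. indicator A \<omega> * (Z n \<omega>)\<^sup>2 \<partial>M)"
    if A: "A \<in> sets (F n)" for A n
  proof -
    have AM: "A \<in> sets M" using A sets_filtration by blast
    have "(\<integral>\<omega>. indicator A \<omega> * (S (Suc n) \<omega>)\<^sup>2 \<partial>M) =
      (\<integral>\<omega>. indicator A \<omega> * (S n \<omega>)\<^sup>2 + 2 * (indicator A \<omega> * (S n \<omega> * Z n \<omega>)) + indicator A \<omega> * (Z n \<omega>)\<^sup>2 \<partial>M)"
      unfolding S_Suc by (simp add: algebra_simps)
    then show ?thesis
      using ind_int[OF AM S_sq, of n] ind_int[OF AM Z_sq, of n] ind_int[OF AM SZ_int, of n] orth[OF A] by simp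
  qed
  have "(\<lambda>n. \<integral>\<omega>. (S n \<omega>)\<^sup>2 \<partial>M) = (\<lambda>n. \<Sum>t<n. v t)"
  proof
    show "(\<integral>\<omega>. (S n \<omega>)\<^sup>2 \<partial>M) = (\<Sum>t<n. v t)" for n
    proof (induction n)
      case 0
      then show ?case by (simp add: S_def)
    next
      case (Suc n)
      have [simp]: "(\<integral>\<omega>. indicator (space M) \<omega> * f \<omega> \<partial>M) = (\<integral>\<omega>. f \<omega> \<partial>M)" for f :: "'a \<Rightarrow> real"
        by (intro Bochner_Integration.integral_cong) auto
      have "space M \<in> sets (F n)" using sets.top[of "F n"] by (simp add: space_filtration)
      from S2_Suc[OF this] Suc show ?case by (simp add: v_def)
    qed
  qed
  then have EY: "(\<integral>\<omega>. Y n \<omega> \<partial>M) = (\<Sum>t<n. v t) / (real n)\<^sup>2" for n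
    unfolding Y_def power_divide by (simp add: fun_eq_iff)
  have "AE \<omega> in M. (\<lambda>t. Y t \<omega>) \<longlonglongrightarrow> 0"
  proof (rule almost_supermartingale_tendsto_0[of _ "\<lambda>t. v t / (real (Suc t))\<^sup>2"])
    show "Y n \<in> borel_measurable (F n)" for n unfolding Y_def using S_meas[of n] by auto
    show "integrable M (Y n)" for n unfolding Y_def power_divide using S_sq[of n] by auto
    show "Y n \<omega> \<ge> 0" for n \<omega> unfolding Y_def by simp
    show "0 \<le> v t / (real (Suc t))\<^sup>2" for t using v_nonneg[of t] by simp
    show "summable (\<lambda>t. v t / (real (Suc t))\<^sup>2)" by (rule v_sum)
    show "(\<lambda>t. \<integral>\<omega>. Y t \<omega> \<partial>M) \<longlonglongrightarrow> 0" unfolding EY by (rule kronecker_nonneg[OF v_nonneg v_sum])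
    show "(\<integral>\<omega>. indicator A \<omega> * Y (Suc n) \<omega> \<partial>M) \<le> (\<integral>\<omega>. indicator A \<omega> * Y n \<omega> \<partial>M) + v n / (real (Suc n))\<^sup>2"
      if A: "A \<in> sets (F n)" for n A
    proof -
      have AM: "A \<in> sets M" using A sets_filtration by blast
      have AZ: "(\<integral>\<omega>. indicator A \<omega> * (Z n \<omega>)\<^sup>2 \<partial>M) \<le> v n"
        unfolding v_def by (intro integral_mono ind_int AM Z_sq) (auto simp: indicator_def)
      have AS: "(\<integral>\<omega>. indicator A \<omega> * (S n \<omega>)\<^sup>2 \<partial>M) / (real (Suc n))\<^sup>2 \<le> (\<integral>\<omega>. indicator A \<omega> * Y n \<omega> \<partial>M)"
      \<comment> \<open>At \<open>n = 0\<close> the average divides by zero, but both sides are 0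
        because \<open>S 0\<close> is an empty sum.\<close>
      proof (cases "n = 0")
        case True
        then show ?thesis by (simp add: S_def Y_def)
      next
        case False
        have "(\<integral>\<omega>. indicator A \<omega> * (S n \<omega>)\<^sup>2 \<partial>M) / (real (Suc n))\<^sup>2 \<le> (\<integral>\<omega>. indicator A \<omega> * (S n \<omega>)\<^sup>2 \<partial>M) / (real n)\<^sup>2"
          using False by (intro divide_left_mono power_mono) (auto intro!: Bochner_Integration.integral_nonneg)
        then show ?thesis by (simp add: Y_def power_divide)
      qed
      have "(\<integral>\<omega>. indicator A \<omega> * Y (Suc n) \<omega> \<partial>M) = (\<integral>\<omega>. indicator A \<omega> * (S (Suc n) \<omega>)\<^sup>2 \<partial>M) / (real (Suc n))\<^sup>2"
        by (simp add: Y_def power_divide)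
      also have "\<dots> = (\<integral>\<omega>. indicator A \<omega> * (S n \<omega>)\<^sup>2 \<partial>M) / (real (Suc n))\<^sup>2 +
          (\<integral>\<omega>. indicator A \<omega> * (Z n \<omega>)\<^sup>2 \<partial>M) / (real (Suc n))\<^sup>2"
        unfolding S2_Suc[OF A] by (rule add_divide_distrib)
      also have "\<dots> \<le> (\<integral>\<omega>. indicator A \<omega> * Y n \<omega> \<partial>M) + v n / (real (Suc n))\<^sup>2"
        by (intro add_mono AS divide_right_mono AZ) auto
      finally show ?thesis .
    qed
  qed
  then show ?thesis
  proof eventually_elim
    case (elim \<omega>)
    then have "(\<lambda>n. sqrt (Y n \<omega>)) \<longlonglongrightarrow> sqrt 0" by (rule tendsto_real_sqrt)
    then have "(\<lambda>n. \<bar>S n \<omega> / real n\<bar>) \<longlonglongrightarrow> 0" by (simp add: Y_def)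
    then have "(\<lambda>n. S n \<omega> / real n) \<longlonglongrightarrow> 0" by (rule tendsto_rabs_zero_cancel)
    then show ?case by (simp add: S_def Z_def E_def)
  qed
qed

end

section \<open>Quadratic Lyapunov drift\<close>

text \<open>The sequences differ in finitely many terms, whose total is divided out by
  \<open>n\<close>. This undoes the truncation path by path.\<close>

lemma cesaro_null_cong:
  fixes f g :: "nat \<Rightarrow> real"
  assumes f: "(\<lambda>n. (\<Sum>t<n. f t) / real n) \<longlonglongrightarrow> 0"
    and eq: "\<forall>\<^sub>F t in sequentially. f t = g t"
  shows "(\<lambda>n. (\<Sum>t<n. g t) / real n) \<longlonglongrightarrow> 0"
proof -
  from eq obtain m where m: "\<And>t. t \<ge> m \<Longrightarrow> f t = g t" by (auto simp: eventually_sequentially)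
  have "summable (\<lambda>t. g t - f t)"
    by (rule summable_finite[of "{..<m}"]) (use m in \<open>auto simp: not_less\<close>)
  then have "(\<lambda>n. \<Sum>t<n. g t - f t) \<longlonglongrightarrow> (\<Sum>t. g t - f t)" by (rule summable_LIMSEQ)
  from tendsto_mult[OF this lim_inverse_n] have "(\<lambda>n. (\<Sum>t<n. g t - f t) / real n) \<longlonglongrightarrow> 0"
    by (simp add: divide_inverse)
  from tendsto_add[OF this f] show ?thesis
    by (simp add: sum_subtractf diff_divide_distrib)
qed

text \<open>The truncation \<open>h \<le> k * y ^ 4\<close> with \<open>k = sqrt c\<close> trades
  three of the four factors in \<open>h ^ 4\<close> for powers of \<open>y\<close>. A single factor
  \<open>h\<close> remains, and its mean is what the drift inequality controls.\<close>

lemma square_le_of_truncated: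
  fixes c h s y :: real
  assumes y: "y \<ge> 1" and h: "h \<ge> 0" and s: "s \<ge> 0" and c: "c \<ge> 0" and hc: "h\<^sup>2 \<le> c * y ^ 8"
  shows "(h * s + s\<^sup>2)\<^sup>2 \<le> (sqrt c ^ 3 + 3) * y ^ 6 * (h + s ^ 4)"
proof -
  define k where "k = sqrt c"
  have k: "k \<ge> 0" and kc: "c = k\<^sup>2" using c by (auto simp: k_def)
  have "h\<^sup>2 \<le> (k * y ^ 4)\<^sup>2" using hc by (simp add: kc power_mult_distrib flip: power_mult)
  then have "h \<le> k * y ^ 4" by (rule power2_le_imp_le) (use k y in simp)
  then have "h ^ 3 \<le> (k * y ^ 4) ^ 3" using h by (rule power_mono)
  then have "h * h ^ 3 \<le> h * (k ^ 3 * y ^ 12)"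
    using h by (intro mult_left_mono) (auto simp: power_mult_distrib simp flip: power_mult)
  moreover have "h ^ 4 = h * h ^ 3" by (simp add: eval_nat_numeral)
  ultimately have h4: "h ^ 4 \<le> k ^ 3 * h * y ^ 12" by (simp add: mult_ac)
  have "y ^ 6 > 0" "y ^ 6 \<ge> 1" using y by auto
  \<comment> \<open>Young's inequality with weight \<open>y ^ 6\<close>: both \<open>h ^ 4\<close>
    and the weighted \<open>s ^ 4\<close> are then of order \<open>y ^ 12\<close>, and cancelling
    one \<open>y ^ 6\<close> leaves the same power on both terms.\<close>
  have "2 * (h\<^sup>2 * (s\<^sup>2 * y ^ 6)) \<le> (h\<^sup>2)\<^sup>2 + (s\<^sup>2 * y ^ 6)\<^sup>2"
    using sum_squares_bound[of "h\<^sup>2" "s\<^sup>2 * y ^ 6"] by simp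
  also have "\<dots> = h ^ 4 + s ^ 4 * y ^ 12" by (simp add: power_mult_distrib flip: power_mult)
  also have "\<dots> \<le> k ^ 3 * h * y ^ 12 + s ^ 4 * y ^ 12" using h4 by simp
  also have "\<dots> = y ^ 6 * (k ^ 3 * h * y ^ 6 + s ^ 4 * y ^ 6)" by (simp add: algebra_simps flip: power_add)
  finally have "y ^ 6 * (2 * (h\<^sup>2 * s\<^sup>2)) \<le> y ^ 6 * (k ^ 3 * h * y ^ 6 + s ^ 4 * y ^ 6)"
    by (simp add: algebra_simps)
  then have 1: "2 * (h\<^sup>2 * s\<^sup>2) \<le> k ^ 3 * h * y ^ 6 + s ^ 4 * y ^ 6"
    using \<open>y ^ 6 > 0\<close> mult_le_cancel_left_pos by blast
  have 2: "s ^ 4 \<le> s ^ 4 * y ^ 6"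
    using mult_left_mono[OF \<open>y ^ 6 \<ge> 1\<close>, of "s ^ 4"] by simp
  have "(h * s + s\<^sup>2)\<^sup>2 \<le> 2 * ((h * s)\<^sup>2 + (s\<^sup>2)\<^sup>2)"
    using sum_squares_bound[of "h * s" "s\<^sup>2"] by (simp add: power2_sum)
  also have "\<dots> = 2 * (h\<^sup>2 * s\<^sup>2) + 2 * s ^ 4" by (simp add: power_mult_distrib flip: power_mult)
  also have "\<dots> \<le> k ^ 3 * h * y ^ 6 + 3 * (s ^ 4 * y ^ 6)" using 1 2 by linarith
  \<comment> \<open>The nonnegative cross terms are added only to make the bound factor.\<close>
  also have "\<dots> \<le> k ^ 3 * h * y ^ 6 + 3 * (s ^ 4 * y ^ 6) + (3 * (h * y ^ 6) + k ^ 3 * (s ^ 4 * y ^ 6))"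
    using h k y by simp
  also have "\<dots> = (k ^ 3 + 3) * y ^ 6 * (h + s ^ 4)" by (simp add: algebra_simps)
  finally show ?thesis by (simp add: k_def)
qed

text \<open>The vector process is reduced to three scalar ones: the Lyapunov value \<open>L\<close>,
  the size \<open>h\<close> of the state and the size \<open>S\<close> of its increment. The
  inequalities \<open>h_le\<close> and \<open>L_increment\<close> encode that \<open>L\<close> is
  quadratic. Integrability of \<open>L\<close> is not part of the setting, because the initial state
  is merely finite.\<close>

locale quadratic_drift = filtered_prob_space +
  fixes L h S :: "nat \<Rightarrow> 'a \<Rightarrow> real" and c C D \<epsilon> :: real
  assumes L_meas: "\<And>t. L t \<in> borel_measurable (F t)"
    and h_meas: "\<And>t. h t \<in> borel_measurable (F t)"
    and S_meas[measurable]: "\<And>t. S t \<in> borel_measurable M"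
    and L_nonneg: "\<And>t \<omega>. L t \<omega> \<ge> 0"
    and h_nonneg: "\<And>t \<omega>. h t \<omega> \<ge> 0"
    and S_nonneg: "\<And>t \<omega>. S t \<omega> \<ge> 0"
    and c_nonneg: "c \<ge> 0"
    and \<epsilon>_pos: "\<epsilon> > 0"
    and h_le: "\<And>t \<omega>. (h t \<omega>)\<^sup>2 \<le> c * L t \<omega>"
    and L_increment: "\<And>t \<omega>. \<bar>L (Suc t) \<omega> - L t \<omega>\<bar> \<le> c * (h t \<omega> * S t \<omega> + (S t \<omega>)\<^sup>2)"
    and S4_int: "\<And>t. integrable M (\<lambda>\<omega>. S t \<omega> ^ 4)"
    and S4_le: "\<And>t. (\<integral>\<omega>. S t \<omega> ^ 4 \<partial>M) \<le> D"
    and drift: "\<And>t. AE \<omega> in M. real_cond_exp M (F t) (\<lambda>\<omega>. L (Suc t) \<omega> - L t \<omega>) \<omega> \<le> C - \<epsilon> * h t \<omega>"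
begin

section \<open>Localisation to a bounded initial Lyapunov value\<close>

lemma borel_L[measurable]: "L t \<in> borel_measurable M"
  and borel_h[measurable]: "h t \<in> borel_measurable M"
  using L_meas h_meas measurable_filtration by blast+

lemma integrable_S2: "integrable M (\<lambda>\<omega>. (S t \<omega>)\<^sup>2)"
  by (rule square_integrable_imp_integrable) (use S4_int[of t] in \<open>auto simp flip: power_mult\<close>)

text \<open>On these events \<open>L 0\<close> is bounded, hence integrable. They belong to every
  \<open>F t\<close>, and they exhaust the space as \<open>N\<close> grows.\<close>

definition start :: "real \<Rightarrow> 'a set" where
  "start N = {\<omega>\<in>space M. L 0 \<omega> \<le> N}"

lemma start_filtration: "start N \<in> sets (F t)"
proof -
  have "L 0 \<in> borel_measurable (F t)" by (rule measurable_filtration_mono[OF L_meas]) simp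
  then have "{\<omega>\<in>space (F t). L 0 \<omega> \<le> N} \<in> sets (F t)" by measurable
  then show ?thesis by (simp add: start_def space_filtration)
qed

lemma start_sets[measurable]: "start N \<in> sets M"
  using start_filtration sets_filtration by blast

text \<open>Integrability propagates in time: bounding \<open>h t \<omega> * S t \<omega>\<close> by
  squares and using \<open>h_le\<close> controls \<open>L (Suc t)\<close> by multiples of
  \<open>L t\<close> and \<open>(S t \<omega>)\<^sup>2\<close>.\<close>

lemma start_L_int: "integrable M (\<lambda>\<omega>. indicator (start N) \<omega> * L t \<omega>)"
proof (induction t)
  case 0
  show ?case
    by (rule Bochner_Integration.integrable_bound[of _ "\<lambda>\<omega>. N"])
      (auto simp: start_def indicator_def L_nonneg split: if_splits)
next
  case (Suc t)
  have le: "L (Suc t) \<omega> \<le> (1 + c\<^sup>2) * L t \<omega> + 2 * c * (S t \<omega>)\<^sup>2" for \<omega>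
  proof -
    have "2 * (h t \<omega> * S t \<omega>) \<le> (h t \<omega>)\<^sup>2 + (S t \<omega>)\<^sup>2"
      using sum_squares_bound[of "h t \<omega>" "S t \<omega>"] by simp
    then have "h t \<omega> * S t \<omega> + (S t \<omega>)\<^sup>2 \<le> c * L t \<omega> + 2 * (S t \<omega>)\<^sup>2"
      using h_le[of t \<omega>] h_nonneg[of t \<omega>] S_nonneg[of t \<omega>] mult_nonneg_nonneg[of "h t \<omega>" "S t \<omega>"]
        zero_le_power2[of "S t \<omega>"] by linarith
    then have "c * (h t \<omega> * S t \<omega> + (S t \<omega>)\<^sup>2) \<le> c * (c * L t \<omega> + 2 * (S t \<omega>)\<^sup>2)"
      using c_nonneg by (rule mult_left_mono)
    with L_increment[of t \<omega>] show ?thesis by (simp add: algebra_simps power2_eq_square)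
  qed
  have "integrable M (\<lambda>\<omega>. (1 + c\<^sup>2) * (indicator (start N) \<omega> * L t \<omega>) + 2 * c * (S t \<omega>)\<^sup>2)"
    using Suc integrable_S2 by auto
  then show ?case
  proof (rule Bochner_Integration.integrable_bound)
    show "AE \<omega> in M. norm (indicator (start N) \<omega> * L (Suc t) \<omega>)
        \<le> norm ((1 + c\<^sup>2) * (indicator (start N) \<omega> * L t \<omega>) + 2 * c * (S t \<omega>)\<^sup>2)"
    proof (rule AE_I2)
      fix \<omega>
      show "norm (indicator (start N) \<omega> * L (Suc t) \<omega>)
        \<le> norm ((1 + c\<^sup>2) * (indicator (start N) \<omega> * L t \<omega>) + 2 * c * (S t \<omega>)\<^sup>2)"
        using le[of \<omega>] L_nonneg[of "Suc t" \<omega>] L_nonneg[of t \<omega>] c_nonneg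
        by (auto simp: indicator_def)
    qed
  qed auto
qed

lemma sub_start_L_int:
  assumes "A \<in> sets M" "A \<subseteq> start N"
  shows "integrable M (\<lambda>\<omega>. indicator A \<omega> * L t \<omega>)"
proof -
  have "integrable M (\<lambda>\<omega>. indicator A \<omega> * (indicator (start N) \<omega> * L t \<omega>))"
    using integrable_mult_indicator[OF assms(1) start_L_int] by simp
  moreover have "indicator A \<omega> * (indicator (start N) \<omega> * L t \<omega>) = indicator A \<omega> * L t \<omega>" for \<omega>
    using assms(2) by (auto simp: indicator_def)
  ultimately show ?thesis by simp
qed

lemma sub_start_h_int:
  assumes [measurable]: "A \<in> sets M" and A: "A \<subseteq> start N"
  shows "integrable M (\<lambda>\<omega>. indicator A \<omega> * h t \<omega>)"
proof (rule Bochner_Integration.integrable_bound)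
  show "integrable M (\<lambda>\<omega>. 1 + c * (indicator A \<omega> * L t \<omega>))"
    using sub_start_L_int[OF assms] by auto
  show "AE \<omega> in M. norm (indicator A \<omega> * h t \<omega>) \<le> norm (1 + c * (indicator A \<omega> * L t \<omega>))"
  proof (rule AE_I2)
    fix \<omega>
    have "h t \<omega> \<le> 1 + (h t \<omega>)\<^sup>2"
      using sum_squares_bound[of "h t \<omega>" 1] h_nonneg[of t \<omega>] by simp
    then show "norm (indicator A \<omega> * h t \<omega>) \<le> norm (1 + c * (indicator A \<omega> * L t \<omega>))"
      using h_le[of t \<omega>] h_nonneg[of t \<omega>] L_nonneg[of t \<omega>] c_nonneg by (auto simp: indicator_def)
  qed
qed measurable

text \<open>The increment of \<open>L\<close> may fail to be integrable, but its product with
  \<open>indicator A\<close> is integrable, and that product is what the defining property of the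
  conditional expectation is applied to. The absolute value of \<open>C\<close> appears because the
  constant is integrated over the whole space instead of \<open>A\<close>.\<close>

lemma drift_on_event:
  assumes A: "A \<in> sets (F t)" "A \<subseteq> start N"
  shows "(\<integral>\<omega>. indicator A \<omega> * L (Suc t) \<omega> \<partial>M)
    \<le> (\<integral>\<omega>. indicator A \<omega> * L t \<omega> \<partial>M) + \<bar>C\<bar> - \<epsilon> * (\<integral>\<omega>. indicator A \<omega> * h t \<omega> \<partial>M)"
proof -
  interpret sigma_finite_subalgebra M "F t" by (rule sigma_finite_subalgebra_filtration)
  have AM[measurable]: "A \<in> sets M" using A sets_filtration by blast
  note int = sub_start_L_int[OF AM A(2)] sub_start_h_int[OF AM A(2)]
  let ?d = "\<lambda>\<omega>. L (Suc t) \<omega> - L t \<omega>"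
  have int_d: "integrable M (\<lambda>\<omega>. indicator A \<omega> * ?d \<omega>)"
    using int(1)[of "Suc t"] int(1)[of t] by (simp add: right_diff_distrib)
  have indA: "(indicator A :: 'a \<Rightarrow> real) \<in> borel_measurable (F t)" using A by simp
  have "(\<integral>\<omega>. indicator A \<omega> * L (Suc t) \<omega> \<partial>M) - (\<integral>\<omega>. indicator A \<omega> * L t \<omega> \<partial>M)
      = (\<integral>\<omega>. indicator A \<omega> * ?d \<omega> \<partial>M)"
    using int(1)[of "Suc t"] int(1)[of t] by (simp add: right_diff_distrib)
  also have "\<dots> = (\<integral>\<omega>. indicator A \<omega> * real_cond_exp M (F t) ?d \<omega> \<partial>M)"
    using real_cond_exp_intg(2)[OF int_d indA] by simp
  also have "\<dots> \<le> (\<integral>\<omega>. \<bar>C\<bar> - \<epsilon> * (indicator A \<omega> * h t \<omega>) \<partial>M)"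
  proof (rule integral_mono_AE)
    show "integrable M (\<lambda>\<omega>. indicator A \<omega> * real_cond_exp M (F t) ?d \<omega>)"
      using real_cond_exp_intg(1)[OF int_d indA] by simp
    show "integrable M (\<lambda>\<omega>. \<bar>C\<bar> - \<epsilon> * (indicator A \<omega> * h t \<omega>))" using int(2)[of t] by auto
    show "AE \<omega> in M. indicator A \<omega> * real_cond_exp M (F t) ?d \<omega> \<le> \<bar>C\<bar> - \<epsilon> * (indicator A \<omega> * h t \<omega>)"
      using drift[of t] by eventually_elim (auto simp: indicator_def)
  qed
  also have "\<dots> = \<bar>C\<bar> - \<epsilon> * (\<integral>\<omega>. indicator A \<omega> * h t \<omega> \<partial>M)"
    using int(2)[of t] by (simp add: prob_space)
  finally show ?thesis by linarith
qed

text \<open>The exponent is chosen so that, with \<open>y = (t + 1) powr (1/7)\<close>, the normalisation of the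
  Lyapunov function is \<open>y ^ 8\<close> and that of the strong law is \<open>y ^ 14\<close>; any exponent strictly
  between 1 and \<open>8/7\<close> would do as well.\<close>

definition y :: "nat \<Rightarrow> real" where
  "y t = real (Suc t) powr (1/7)"

lemma y_ge_1: "y t \<ge> 1"
  unfolding y_def by (intro ge_one_powr_ge_zero) auto

lemma y_pos: "y t > 0"
  using y_ge_1[of t] by linarith

lemma y_nonzero: "y t \<noteq> 0"
  using y_pos[of t] by simp

lemma y_power7: "y t ^ 7 = real (Suc t)"
  unfolding y_def by (simp add: powr_power)

lemma y_mono: "y t \<le> y (Suc t)"
  unfolding y_def by (intro powr_mono2) auto

lemma summable_y: "summable (\<lambda>t. 1 / y t ^ 8)"
proof -
  have "summable (\<lambda>t. real (Suc t) powr (-(8/7)))"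
    by (subst summable_Suc_iff) (simp add: summable_real_powr_iff)
  moreover have "real (Suc t) powr (-(8/7)) = 1 / y t ^ 8" for t
    unfolding y_def by (simp add: powr_power powr_minus_divide)
  ultimately show ?thesis by simp
qed

section \<open>Lyapunov value and state norm at the scale \<open>y t ^ 8\<close>\<close>

lemma start_L_growth:
  "(\<integral>\<omega>. indicator (start N) \<omega> * L t \<omega> \<partial>M) \<le> (\<integral>\<omega>. indicator (start N) \<omega> * L 0 \<omega> \<partial>M) + \<bar>C\<bar> * real t"
proof (induction t)
  case (Suc t)
  have "0 \<le> \<epsilon> * (\<integral>\<omega>. indicator (start N) \<omega> * h t \<omega> \<partial>M)"
    using \<epsilon>_pos h_nonneg by (intro mult_nonneg_nonneg Bochner_Integration.integral_nonneg) auto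
  with drift_on_event[OF start_filtration[of N t] order_refl] Suc show ?case
    by (simp add: algebra_simps)
qed simp

text \<open>Without its \<open>h\<close> term the drift inequality adds at most
  \<open>\<bar>C\<bar>\<close> per step. Divided by the increasing \<open>y t ^ 8\<close>, of order
  \<open>t powr (8/7)\<close>, these errors are summable, and the linearly growing means tend to
  0.\<close>

lemma L_scaled_tendsto_0:
  "AE \<omega> in M. (\<lambda>t. indicator (start N) \<omega> * L t \<omega> / y t ^ 8) \<longlonglongrightarrow> 0"
proof (rule almost_supermartingale_tendsto_0[of _ "\<lambda>t. \<bar>C\<bar> * (1 / y t ^ 8)"])
  show "(\<lambda>\<omega>. indicator (start N) \<omega> * L t \<omega> / y t ^ 8) \<in> borel_measurable (F t)" for t
    using start_filtration[of N t] L_meas[of t] by auto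
  show "integrable M (\<lambda>\<omega>. indicator (start N) \<omega> * L t \<omega> / y t ^ 8)" for t
    using start_L_int[of N t] by auto
  show "0 \<le> indicator (start N) \<omega> * L t \<omega> / y t ^ 8" for t \<omega>
    using L_nonneg[of t \<omega>] y_pos[of t] by simp
  show "0 \<le> \<bar>C\<bar> * (1 / y t ^ 8)" for t using y_pos[of t] by simp
  show "summable (\<lambda>t. \<bar>C\<bar> * (1 / y t ^ 8))" by (intro summable_mult summable_y)
  show "(\<integral>\<omega>. indicator A \<omega> * (indicator (start N) \<omega> * L (Suc t) \<omega> / y (Suc t) ^ 8) \<partial>M)
      \<le> (\<integral>\<omega>. indicator A \<omega> * (indicator (start N) \<omega> * L t \<omega> / y t ^ 8) \<partial>M) + \<bar>C\<bar> * (1 / y t ^ 8)"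
    if A: "A \<in> sets (F t)" for A t
  proof -
    let ?A = "A \<inter> start N"
    have A': "?A \<in> sets (F t)" "?A \<subseteq> start N" using A start_filtration by auto
    have eq: "(\<integral>\<omega>. indicator A \<omega> * (indicator (start N) \<omega> * L s \<omega> / y s ^ 8) \<partial>M)
      = (\<integral>\<omega>. indicator ?A \<omega> * L s \<omega> \<partial>M) / y s ^ 8" for s
      by (simp add: indicator_inter_arith mult.assoc)
    have nonneg: "(\<integral>\<omega>. indicator ?A \<omega> * L (Suc t) \<omega> \<partial>M) \<ge> 0"
      using L_nonneg by (intro Bochner_Integration.integral_nonneg) auto
    have "0 \<le> \<epsilon> * (\<integral>\<omega>. indicator ?A \<omega> * h t \<omega> \<partial>M)"
      using \<epsilon>_pos h_nonneg by (intro mult_nonneg_nonneg Bochner_Integration.integral_nonneg) auto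
    with drift_on_event[OF A'] have *: "(\<integral>\<omega>. indicator ?A \<omega> * L (Suc t) \<omega> \<partial>M)
        \<le> (\<integral>\<omega>. indicator ?A \<omega> * L t \<omega> \<partial>M) + \<bar>C\<bar>" by linarith
    have "(\<integral>\<omega>. indicator ?A \<omega> * L (Suc t) \<omega> \<partial>M) / y (Suc t) ^ 8
        \<le> (\<integral>\<omega>. indicator ?A \<omega> * L (Suc t) \<omega> \<partial>M) / y t ^ 8"
      using y_mono[of t] y_pos nonneg by (intro divide_left_mono power_mono mult_pos_pos) (simp_all add: less_imp_le y_pos y_nonzero)
    also have "\<dots> \<le> ((\<integral>\<omega>. indicator ?A \<omega> * L t \<omega> \<partial>M) + \<bar>C\<bar>) / y t ^ 8"
      using * y_pos[of t] by (intro divide_right_mono) auto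
    finally show ?thesis unfolding eq by (simp add: add_divide_distrib)
  qed
  let ?c0 = "\<integral>\<omega>. indicator (start N) \<omega> * L 0 \<omega> \<partial>M"
  have bound: "norm (\<integral>\<omega>. indicator (start N) \<omega> * L t \<omega> / y t ^ 8 \<partial>M) \<le> (?c0 + \<bar>C\<bar> * real t) / y t ^ 8" for t
  proof -
    have "(\<integral>\<omega>. indicator (start N) \<omega> * L t \<omega> \<partial>M) / y t ^ 8 \<le> (?c0 + \<bar>C\<bar> * real t) / y t ^ 8"
      using y_pos[of t] by (intro divide_right_mono start_L_growth) auto
    moreover have "0 \<le> (\<integral>\<omega>. indicator (start N) \<omega> * L t \<omega> \<partial>M) / y t ^ 8"
      using y_pos[of t] L_nonneg by (intro divide_nonneg_pos Bochner_Integration.integral_nonneg) auto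
    ultimately show ?thesis by simp
  qed
  have "(\<lambda>t. (a + b * real t) / real (Suc t) powr (8/7)) \<longlonglongrightarrow> 0" for a b :: real by real_asymp
  moreover have "real (Suc t) powr (8/7) = y t ^ 8" for t unfolding y_def by (simp add: powr_power)
  ultimately have "(\<lambda>t. (?c0 + \<bar>C\<bar> * real t) / y t ^ 8) \<longlonglongrightarrow> 0" by simp
  then show "(\<lambda>t. \<integral>\<omega>. indicator (start N) \<omega> * L t \<omega> / y t ^ 8 \<partial>M) \<longlonglongrightarrow> 0"
    by (rule Lim_null_comparison[OF always_eventually[OF allI[OF bound]]])
qed

text \<open>Here the \<open>h\<close> term is kept. Dividing the drift inequality by
  \<open>y t ^ 8\<close> and summing telescopes up to an inequality in the right direction, since
  \<open>y\<close> increases and \<open>l\<close> is nonnegative; the constant part is summable, so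
  the weighted means of \<open>h\<close> have bounded partial sums.\<close>

lemma summable_start_h:
  "summable (\<lambda>t. (\<integral>\<omega>. indicator (start N) \<omega> * h t \<omega> \<partial>M) / y t ^ 8)"
proof -
  define l where "l t = (\<integral>\<omega>. indicator (start N) \<omega> * L t \<omega> \<partial>M)" for t
  define u where "u t = (\<integral>\<omega>. indicator (start N) \<omega> * h t \<omega> \<partial>M)" for t
  have l_nonneg: "l t \<ge> 0" and u_nonneg: "u t \<ge> 0" for t
    unfolding l_def u_def using L_nonneg h_nonneg by (auto intro!: Bochner_Integration.integral_nonneg)
  have "l n / y n ^ 8 + \<epsilon> * (\<Sum>t<n. u t / y t ^ 8) \<le> l 0 + \<bar>C\<bar> * (\<Sum>t<n. 1 / y t ^ 8)" for n
  proof (induction n)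
    case 0
    then show ?case using y_power7[of 0] by (simp add: y_def)
  next
    case (Suc n)
    have "l (Suc n) / y (Suc n) ^ 8 \<le> l (Suc n) / y n ^ 8"
      using y_mono[of n] y_pos l_nonneg by (intro divide_left_mono power_mono mult_pos_pos) (simp_all add: less_imp_le y_pos y_nonzero)
    also have "\<dots> \<le> (l n + \<bar>C\<bar> - \<epsilon> * u n) / y n ^ 8"
      using drift_on_event[OF start_filtration[of N n] order_refl] y_pos[of n]
      by (intro divide_right_mono) (auto simp: l_def u_def)
    also have "\<dots> = l n / y n ^ 8 + \<bar>C\<bar> * (1 / y n ^ 8) - \<epsilon> * (u n / y n ^ 8)"
      by (simp add: add_divide_distrib diff_divide_distrib)
    finally show ?case using Suc by (simp add: algebra_simps)
  qed
  moreover have "(\<Sum>t<n. 1 / y t ^ 8) \<le> (\<Sum>t. 1 / y t ^ 8)" for n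
    using y_pos by (intro sum_le_suminf summable_y) (simp_all add: less_imp_le y_pos y_nonzero)
  ultimately have "\<epsilon> * (\<Sum>t<n. u t / y t ^ 8) \<le> l 0 + \<bar>C\<bar> * (\<Sum>t. 1 / y t ^ 8)" for n
  proof -
    have "\<bar>C\<bar> * (\<Sum>t<n. 1 / y t ^ 8) \<le> \<bar>C\<bar> * (\<Sum>t. 1 / y t ^ 8)"
      using \<open>(\<Sum>t<n. 1 / y t ^ 8) \<le> (\<Sum>t. 1 / y t ^ 8)\<close> by (rule mult_left_mono) simp
    moreover have "l n / y n ^ 8 \<ge> 0" using l_nonneg[of n] y_pos[of n] by simp
    ultimately show ?thesis
      using \<open>l n / y n ^ 8 + \<epsilon> * (\<Sum>t<n. u t / y t ^ 8) \<le> l 0 + \<bar>C\<bar> * (\<Sum>t<n. 1 / y t ^ 8)\<close> by linarith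
  qed
  then have "(\<Sum>t<n. u t / y t ^ 8) \<le> (l 0 + \<bar>C\<bar> * (\<Sum>t. 1 / y t ^ 8)) / \<epsilon>" for n
    using \<epsilon>_pos by (simp add: pos_le_divide_eq mult.commute)
  then have "summable (\<lambda>t. u t / y t ^ 8)"
    by (rule summableI_nonneg_bounded[rotated]) (use u_nonneg y_pos in \<open>simp add: less_imp_le\<close>)
  then show ?thesis by (simp add: u_def)
qed

section \<open>Increments truncated by the current Lyapunov value\<close>

definition trunc :: "real \<Rightarrow> nat \<Rightarrow> 'a set" where
  "trunc N t = {\<omega>\<in>start N. L t \<omega> \<le> y t ^ 8}"

lemma trunc_filtration: "trunc N t \<in> sets (F t)"
proof -
  have "{\<omega>\<in>space (F t). L t \<omega> \<le> y t ^ 8} \<in> sets (F t)"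
    using L_meas[of t] by measurable
  then have "start N \<inter> {\<omega>\<in>space (F t). L t \<omega> \<le> y t ^ 8} \<in> sets (F t)"
    using start_filtration by blast
  also have "start N \<inter> {\<omega>\<in>space (F t). L t \<omega> \<le> y t ^ 8} = trunc N t"
    by (auto simp: trunc_def start_def space_filtration)
  finally show ?thesis .
qed

lemma trunc_sets[measurable]: "trunc N t \<in> sets M"
  using trunc_filtration sets_filtration by blast

text \<open>The cut looks at the state at time \<open>t\<close> and not at the size of the
  increment. Its indicator is therefore \<open>F t\<close>-measurable and can be pulled out of the
  conditional expectation.\<close>

definition trunc_incr :: "real \<Rightarrow> nat \<Rightarrow> 'a \<Rightarrow> real" where
  "trunc_incr N t \<omega> = indicator (trunc N t) \<omega> * (L (Suc t) \<omega> - L t \<omega>)"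

definition var_const :: real where
  "var_const = c\<^sup>2 * (sqrt c ^ 3 + 3)"

text \<open>On \<open>trunc N t\<close> the bound \<open>h_le\<close> gives exactly the hypothesis
  of \<open>square_le_of_truncated\<close>. The right side is relaxed to \<open>start N\<close>, the
  event on which \<open>summable_start_h\<close> controls the mean of \<open>h\<close>.\<close>

lemma trunc_incr_square_le:
  "(trunc_incr N t \<omega>)\<^sup>2 \<le> var_const * y t ^ 6 * (indicator (start N) \<omega> * h t \<omega> + S t \<omega> ^ 4)"
proof (cases "\<omega> \<in> trunc N t")
  case True
  then have L: "L t \<omega> \<le> y t ^ 8" and st: "\<omega> \<in> start N" by (auto simp: trunc_def)
  have "(h t \<omega>)\<^sup>2 \<le> c * y t ^ 8"
    using h_le[of t \<omega>] mult_left_mono[OF L c_nonneg] by linarith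
  then have *: "(h t \<omega> * S t \<omega> + (S t \<omega>)\<^sup>2)\<^sup>2 \<le> (sqrt c ^ 3 + 3) * y t ^ 6 * (h t \<omega> + S t \<omega> ^ 4)"
    by (intro square_le_of_truncated y_ge_1 h_nonneg S_nonneg c_nonneg)
  have "(trunc_incr N t \<omega>)\<^sup>2 = \<bar>L (Suc t) \<omega> - L t \<omega>\<bar>\<^sup>2" using True by (simp add: trunc_incr_def)
  also have "\<dots> \<le> (c * (h t \<omega> * S t \<omega> + (S t \<omega>)\<^sup>2))\<^sup>2"
    by (intro power_mono L_increment) simp
  also have "\<dots> \<le> c\<^sup>2 * ((sqrt c ^ 3 + 3) * y t ^ 6 * (h t \<omega> + S t \<omega> ^ 4))"
    unfolding power_mult_distrib by (intro mult_left_mono *) simp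
  finally show ?thesis using st by (simp add: var_const_def mult.assoc)
next
  case False
  then show ?thesis
    using y_pos[of t] h_nonneg[of t \<omega>] c_nonneg by (simp add: trunc_incr_def var_const_def less_imp_le)
qed

lemma trunc_incr_meas: "trunc_incr N t \<in> borel_measurable (F (Suc t))"
proof -
  have "trunc N t \<in> sets (F (Suc t))"
    using trunc_filtration[of N t] filtration_mono[of t "Suc t"] by (auto simp: subalgebra_def)
  moreover have "L t \<in> borel_measurable (F (Suc t))"
    by (rule measurable_filtration_mono[OF L_meas]) simp
  ultimately show ?thesis unfolding trunc_incr_def using L_meas[of "Suc t"] by auto
qed

lemma trunc_incr_borel[measurable]: "trunc_incr N t \<in> borel_measurable M"
  using trunc_incr_meas measurable_filtration by blast

lemma trunc_incr_bound_int:
  "integrable M (\<lambda>\<omega>. var_const * y t ^ 6 * (indicator (start N) \<omega> * h t \<omega> + S t \<omega> ^ 4))"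
  using sub_start_h_int[OF start_sets order_refl] S4_int by auto

lemma trunc_incr_square_int: "integrable M (\<lambda>\<omega>. (trunc_incr N t \<omega>)\<^sup>2)"
  by (rule Bochner_Integration.integrable_bound[OF trunc_incr_bound_int])
    (auto intro!: AE_I2 order_trans[OF trunc_incr_square_le] abs_ge_self)

text \<open>Because \<open>(real (Suc t))\<^sup>2\<close> is \<open>y t ^ 14\<close>, the factor
  \<open>y t ^ 6\<close> in the variance bound leaves the weight \<open>1 / y t ^ 8\<close>. With
  this weight both the means of \<open>h\<close> and a constant are summable.\<close>

lemma trunc_incr_square_summable: "summable (\<lambda>t. (\<integral>\<omega>. (trunc_incr N t \<omega>)\<^sup>2 \<partial>M) / (real (Suc t))\<^sup>2)"
proof (rule summable_comparison_test'[of _ 0])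
  let ?u = "\<lambda>t. \<integral>\<omega>. indicator (start N) \<omega> * h t \<omega> \<partial>M"
  show "summable (\<lambda>t. var_const * (?u t / y t ^ 8 + D * (1 / y t ^ 8)))"
    by (intro summable_mult summable_add summable_start_h summable_y)
  show "norm ((\<integral>\<omega>. (trunc_incr N t \<omega>)\<^sup>2 \<partial>M) / (real (Suc t))\<^sup>2) \<le> var_const * (?u t / y t ^ 8 + D * (1 / y t ^ 8))" for t
  proof -
    have var_const: "var_const \<ge> 0" unfolding var_const_def using c_nonneg by simp
    have "(\<integral>\<omega>. (trunc_incr N t \<omega>)\<^sup>2 \<partial>M) \<le> (\<integral>\<omega>. var_const * y t ^ 6 * (indicator (start N) \<omega> * h t \<omega> + S t \<omega> ^ 4) \<partial>M)"
      by (intro integral_mono trunc_incr_square_int trunc_incr_bound_int trunc_incr_square_le)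
    also have "\<dots> = var_const * y t ^ 6 * (?u t + (\<integral>\<omega>. S t \<omega> ^ 4 \<partial>M))"
      using sub_start_h_int[OF start_sets order_refl, of N t] S4_int[of t] by simp
    also have "\<dots> \<le> var_const * y t ^ 6 * (?u t + D)"
      using S4_le[of t] var_const y_pos[of t] by (intro mult_left_mono) auto
    finally have "(\<integral>\<omega>. (trunc_incr N t \<omega>)\<^sup>2 \<partial>M) / (real (Suc t))\<^sup>2 \<le> var_const * y t ^ 6 * (?u t + D) / (y t ^ 7)\<^sup>2"
      by (simp only: y_power7) (rule divide_right_mono, simp_all)
    also have "\<dots> = var_const * (?u t + D) * (y t ^ 6 / y t ^ 14)"
      by (simp flip: power_mult)
    also have "y t ^ 6 / y t ^ 14 = 1 / y t ^ 8"
      using y_pos[of t] by (simp add: field_simps flip: power_add)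
    finally show ?thesis by (simp add: algebra_simps add_divide_distrib)
  qed
qed

lemma trunc_incr_int: "integrable M (trunc_incr N t)"
  using square_integrable_imp_integrable[OF _ trunc_incr_square_int] by simp

text \<open>On \<open>start N\<close> almost every path eventually satisfies
  \<open>L t \<omega> < y t ^ 8\<close>, so from some random time on the truncated increments and
  their conditional expectations agree with the original ones. The strong law for the former passes
  to the latter. The second claim follows from the same scaled limit, as \<open>y t ^ 8\<close> is
  at most of order \<open>t\<close> squared.\<close>

lemma increments_SLLN:
  "AE \<omega> in M. (\<lambda>n. (\<Sum>t<n. (L (Suc t) \<omega> - L t \<omega>)
      - real_cond_exp M (F t) (\<lambda>\<omega>. L (Suc t) \<omega> - L t \<omega>) \<omega>) / real n) \<longlonglongrightarrow> 0"
  (is "AE \<omega> in M. ?P \<omega>")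
  and L_div_square_tendsto_0: "AE \<omega> in M. (\<lambda>t. L t \<omega> / (real t)\<^sup>2) \<longlonglongrightarrow> 0"
proof -
  let ?d = "\<lambda>t \<omega>. L (Suc t) \<omega> - L t \<omega>"
  \<comment> \<open>Pulling out the indicator requires integrability of the product, which is
    \<open>trunc_incr_int\<close>, and so applies even if the increment itself is not
    integrable.\<close>
  have cond: "AE \<omega> in M. real_cond_exp M (F t) (trunc_incr N t) \<omega> = indicator (trunc N t) \<omega> * real_cond_exp M (F t) (?d t) \<omega>" for N t
  proof -
    interpret sigma_finite_subalgebra M "F t" by (rule sigma_finite_subalgebra_filtration)
    show ?thesis
      unfolding trunc_incr_def by (rule real_cond_exp_mult) (use trunc_filtration trunc_incr_int[of N t] in \<open>auto simp: trunc_incr_def[abs_def]\<close>)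
  qed
  have main: "AE \<omega> in M. \<omega> \<in> start N \<longrightarrow> ?P \<omega> \<and> (\<lambda>t. L t \<omega> / (real t)\<^sup>2) \<longlonglongrightarrow> 0" for N
  proof -
    have "AE \<omega> in M. (\<lambda>n. (\<Sum>t<n. trunc_incr N t \<omega> - real_cond_exp M (F t) (trunc_incr N t) \<omega>) / real n) \<longlonglongrightarrow> 0"
      by (intro martingale_difference_SLLN trunc_incr_meas trunc_incr_square_int trunc_incr_square_summable)
    moreover have "AE \<omega> in M. \<forall>t. real_cond_exp M (F t) (trunc_incr N t) \<omega> = indicator (trunc N t) \<omega> * real_cond_exp M (F t) (?d t) \<omega>"
      by (subst AE_all_countable) (intro allI cond)
    moreover note L_scaled_tendsto_0[of N]
    ultimately show ?thesis
    proof eventually_elim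
      case (elim \<omega>)
      show ?case
      proof (intro impI conjI)
        assume st: "\<omega> \<in> start N"
        with elim(3) have lim: "(\<lambda>t. L t \<omega> / y t ^ 8) \<longlonglongrightarrow> 0" by simp
        then have "\<forall>\<^sub>F t in sequentially. L t \<omega> / y t ^ 8 < 1" by (rule order_tendstoD) simp
        then have "\<forall>\<^sub>F t in sequentially. \<omega> \<in> trunc N t"
        proof eventually_elim
          case (elim t)
          then have "L t \<omega> < 1 * y t ^ 8"
            by (subst (asm) pos_divide_less_eq[OF zero_less_power[OF y_pos]])
          with st show ?case by (simp add: trunc_def)
        qed
        then have "\<forall>\<^sub>F t in sequentially. trunc_incr N t \<omega> - real_cond_exp M (F t) (trunc_incr N t) \<omega>
            = ?d t \<omega> - real_cond_exp M (F t) (?d t) \<omega>"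
          by eventually_elim (use elim(2) in \<open>simp add: trunc_incr_def\<close>)
        then show "?P \<omega>" by (rule cesaro_null_cong[OF elim(1)])
        show "(\<lambda>t. L t \<omega> / (real t)\<^sup>2) \<longlonglongrightarrow> 0"
        proof (rule Lim_null_comparison)
          show "(\<lambda>t. 4 * (L t \<omega> / y t ^ 8)) \<longlonglongrightarrow> 0" using tendsto_mult_right_zero[OF lim, of 4] by simp
          \<comment> \<open>The factor 4 comes from \<open>Suc t \<le> 2 * t\<close>, valid for
            \<open>t \<ge> 1\<close>.\<close>
          have "norm (L t \<omega> / (real t)\<^sup>2) \<le> 4 * (L t \<omega> / y t ^ 8)" if "t \<ge> 1" for t
          proof -
            have "y t ^ 8 \<le> y t ^ 14" using y_ge_1 by (intro power_increasing) auto
            also have "\<dots> = (y t ^ 7)\<^sup>2" by (simp flip: power_mult)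
            also have "\<dots> \<le> (2 * real t)\<^sup>2" unfolding y_power7 using that by (intro power_mono) auto
            finally have "L t \<omega> / (2 * real t)\<^sup>2 \<le> L t \<omega> / y t ^ 8"
              using that y_pos[of t] L_nonneg[of t \<omega>] by (intro divide_left_mono) auto
            then show ?thesis using L_nonneg[of t \<omega>] by (simp add: power_mult_distrib)
          qed
          then show "\<forall>\<^sub>F t in sequentially. norm (L t \<omega> / (real t)\<^sup>2) \<le> 4 * (L t \<omega> / y t ^ 8)"
            by (auto simp: eventually_sequentially)
        qed
      qed
    qed
  qed
  have all: "AE \<omega> in M. \<forall>N. \<omega> \<in> start (real N) \<longrightarrow> ?P \<omega> \<and> (\<lambda>t. L t \<omega> / (real t)\<^sup>2) \<longlonglongrightarrow> 0"
    by (subst AE_all_countable) (intro allI main)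
  \<comment> \<open>Since \<open>L 0\<close> is real-valued, countably many localisations cover the
    space.\<close>
  have ex: "\<exists>N. \<omega> \<in> start (real N)" if "\<omega> \<in> space M" for \<omega>
    using that real_arch_simple[of "L 0 \<omega>"] by (auto simp: start_def)
  from all AE_space show "AE \<omega> in M. ?P \<omega>" by eventually_elim (use ex in blast)
  from all AE_space show "AE \<omega> in M. (\<lambda>t. L t \<omega> / (real t)\<^sup>2) \<longlonglongrightarrow> 0" by eventually_elim (use ex in blast)
qed

end

section \<open>Queue histories and the weighted quadratic Lyapunov function\<close>

lemma hist_generators_Pow:
  "{Q s k -` B \<inter> space M | s k B. s \<le> t \<and> k \<in> {1..K} \<and> B \<in> sets borel} \<union>
   {p s -` B \<inter> space M | s B. s < t \<and> B \<in> sets borel} \<subseteq> Pow (space M)"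
  by auto

lemma space_hist: "space (hist M Q p K t) = space M"
  by (simp add: hist_def space_measure_of_conv)

lemma sets_hist: "sets (hist M Q p K t) = sigma_sets (space M)
    ({Q s k -` B \<inter> space M | s k B. s \<le> t \<and> k \<in> {1..K} \<and> B \<in> sets borel} \<union>
     {p s -` B \<inter> space M | s B. s < t \<and> B \<in> sets borel})"
  unfolding hist_def by (rule sets_measure_of[OF hist_generators_Pow])

lemma subalgebra_hist:
  assumes "\<And>t k. Q t k \<in> borel_measurable M" "\<And>t. p t \<in> borel_measurable M"
  shows "subalgebra M (hist M Q p K t)"
  unfolding subalgebra_def space_hist sets_hist
  using assms by (intro conjI refl sets.sigma_sets_subset) (auto intro: measurable_sets)

lemma hist_mono:
  assumes "s \<le> t"
  shows "subalgebra (hist M Q p K t) (hist M Q p K s)"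
  unfolding subalgebra_def space_hist sets_hist
  using assms by (intro conjI refl sigma_sets_mono' Un_mono) (blast intro: le_trans less_le_trans)+

lemma hist_measurable_Q:
  assumes "s \<le> t" "k \<in> {1..K}"
  shows "Q s k \<in> borel_measurable (hist M Q p K t)"
proof (rule measurableI)
  fix B :: "real set" assume "B \<in> sets borel"
  then show "Q s k -` B \<inter> space (hist M Q p K t) \<in> sets (hist M Q p K t)"
    unfolding space_hist sets_hist using assms by (intro sigma_sets.Basic) blast
qed simp

lemma hist_measurable_p:
  assumes "s < t"
  shows "p s \<in> borel_measurable (hist M Q p K t)"
proof (rule measurableI)
  fix B :: "real set" assume "B \<in> sets borel"
  then show "p s -` B \<inter> space (hist M Q p K t) \<in> sets (hist M Q p K t)"
    unfolding space_hist sets_hist using assms by (intro sigma_sets.Basic) blast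
qed simp

lemma subalgebra_qsig:
  assumes "\<And>t k. Q t k \<in> borel_measurable M"
  shows "subalgebra M (qsig M Q K t)"
proof -
  have "{Q t k -` B \<inter> space M | k B. k \<in> {1..K} \<and> B \<in> sets borel} \<subseteq> Pow (space M)" by auto
  note sets_eq = sets_measure_of[OF this]
  have "space (qsig M Q K t) = space M" by (simp add: qsig_def space_measure_of_conv)
  moreover have "sets (qsig M Q K t) \<subseteq> sets M"
    unfolding qsig_def sets_eq
    by (rule sets.sigma_sets_subset) (use assms in \<open>auto intro: measurable_sets\<close>)
  ultimately show ?thesis by (simp add: subalgebra_def)
qed

lemma lyap_nonneg:
  assumes "\<And>k. k \<in> {1..K} \<Longrightarrow> w k > 0"
  shows "lyap w K q \<ge> 0"
proof -
  have "w k * (q k)\<^sup>2 \<ge> 0" if "k \<in> {1..K}" for k using assms[OF that] by simp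
  then have "(\<Sum>k\<in>{1..K}. w k * (q k)\<^sup>2) \<ge> 0" by (rule sum_nonneg)
  then show ?thesis by (simp add: lyap_def)
qed

text \<open>Cauchy-Schwarz with each term split as \<open>1 / sqrt (w k)\<close> times
  \<open>sqrt (w k) * \<bar>q k\<bar>\<close>; the 2 compensates the one half in
  \<open>lyap\<close>.\<close>

lemma sum_abs_square_le_lyap:
  assumes w: "\<And>k. k \<in> {1..K} \<Longrightarrow> w k > 0"
  shows "(\<Sum>k\<in>{1..K}. \<bar>q k\<bar>)\<^sup>2 \<le> 2 * (\<Sum>k\<in>{1..K}. 1 / w k) * lyap w K q"
proof -
  have "(\<Sum>k\<in>{1..K}. \<bar>q k\<bar>) = (\<Sum>k\<in>{1..K}. (1 / sqrt (w k)) * (sqrt (w k) * \<bar>q k\<bar>))"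
  proof (intro sum.cong refl)
    fix k assume "k \<in> {1..K}"
    from w[OF this] show "\<bar>q k\<bar> = (1 / sqrt (w k)) * (sqrt (w k) * \<bar>q k\<bar>)" by simp
  qed
  then have "(\<Sum>k\<in>{1..K}. \<bar>q k\<bar>)\<^sup>2 \<le> (\<Sum>k\<in>{1..K}. (1 / sqrt (w k))\<^sup>2) * (\<Sum>k\<in>{1..K}. (sqrt (w k) * \<bar>q k\<bar>)\<^sup>2)"
    using Cauchy_Schwarz_ineq_sum[of "\<lambda>k. 1 / sqrt (w k)" "\<lambda>k. sqrt (w k) * \<bar>q k\<bar>" "{1..K}"] by simp
  also have "(\<Sum>k\<in>{1..K}. (1 / sqrt (w k))\<^sup>2) = (\<Sum>k\<in>{1..K}. 1 / w k)"
    using w by (intro sum.cong refl) (simp add: power_divide less_imp_le)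
  also have "(\<Sum>k\<in>{1..K}. (sqrt (w k) * \<bar>q k\<bar>)\<^sup>2) = (\<Sum>k\<in>{1..K}. w k * (q k)\<^sup>2)"
    using w by (intro sum.cong refl) (simp add: power_mult_distrib less_imp_le)
  finally show ?thesis by (simp add: lyap_def)
qed

text \<open>A difference of squares factors, and half of \<open>\<bar>q' k + q k\<bar>\<close> is at
  most the norm of \<open>q\<close> plus that of the increment. The bound is thus the product of
  this sum with the norm of the increment.\<close>

lemma lyap_increment:
  assumes w: "\<And>k. k \<in> {1..K} \<Longrightarrow> w k > 0"
  defines "s \<equiv> \<lambda>q q'. \<Sum>k\<in>{1..K}. \<bar>q' k - q k\<bar>"
  shows "\<bar>lyap w K q' - lyap w K q\<bar>
    \<le> (\<Sum>k\<in>{1..K}. w k) * ((\<Sum>k\<in>{1..K}. \<bar>q k\<bar>) * s q q' + (s q q')\<^sup>2)"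
proof -
  let ?W = "\<Sum>k\<in>{1..K}. w k" and ?h = "\<Sum>k\<in>{1..K}. \<bar>q k\<bar>"
  have term_le: "\<bar>w k * ((q' k)\<^sup>2 - (q k)\<^sup>2) / 2\<bar> \<le> ?W * (?h + s q q') * \<bar>q' k - q k\<bar>" if k: "k \<in> {1..K}" for k
  proof -
    have w': "w j \<ge> 0" if "j \<in> {1..K}" for j using w[OF that] by simp
    have wk: "w k \<ge> 0" "w k \<le> ?W" using w'[OF k] by (simp, intro member_le_sum k w') auto
    have qk: "\<bar>q k\<bar> \<le> ?h" using member_le_sum[OF k, of "\<lambda>k. \<bar>q k\<bar>"] by simp
    have dk: "\<bar>q' k - q k\<bar> \<le> s q q'" unfolding s_def using member_le_sum[OF k, of "\<lambda>k. \<bar>q' k - q k\<bar>"] by simp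
    have "(q' k)\<^sup>2 - (q k)\<^sup>2 = (q' k + q k) * (q' k - q k)" by (simp add: power2_eq_square algebra_simps)
    then have "\<bar>w k * ((q' k)\<^sup>2 - (q k)\<^sup>2) / 2\<bar> = w k * (\<bar>q' k + q k\<bar> / 2) * \<bar>q' k - q k\<bar>"
      using wk by (simp add: abs_mult)
    also have "\<dots> \<le> ?W * (?h + s q q') * \<bar>q' k - q k\<bar>"
      using wk qk dk by (intro mult_right_mono mult_mono) auto
    finally show ?thesis .
  qed
  have "lyap w K q' - lyap w K q = (\<Sum>k\<in>{1..K}. w k * ((q' k)\<^sup>2 - (q k)\<^sup>2) / 2)"
    by (simp add: lyap_def sum_distrib_left sum_subtractf right_diff_distrib diff_divide_distrib)
  then have "\<bar>lyap w K q' - lyap w K q\<bar> \<le> (\<Sum>k\<in>{1..K}. \<bar>w k * ((q' k)\<^sup>2 - (q k)\<^sup>2) / 2\<bar>)"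
    by (simp only: sum_abs)
  also have "\<dots> \<le> (\<Sum>k\<in>{1..K}. ?W * (?h + s q q') * \<bar>q' k - q k\<bar>)"
    by (intro sum_mono term_le)
  also have "\<dots> = ?W * (?h + s q q') * s q q'"
    unfolding s_def by (simp only: sum_distrib_left)
  also have "\<dots> = ?W * (?h * s q q' + (s q q')\<^sup>2)"
    by (simp only: mult.assoc distrib_right power2_eq_square)
  finally show ?thesis .
qed

text \<open>Cauchy-Schwarz against the constant 1, applied twice: the first use, squared, costs two
  factors of the cardinality and the second use one more.\<close>

lemma sum_abs_power4_le:
  fixes x :: "nat \<Rightarrow> real"
  shows "(\<Sum>k\<in>A. \<bar>x k\<bar>) ^ 4 \<le> real (card A) ^ 3 * (\<Sum>k\<in>A. x k ^ 4)"
proof -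
  have "(\<Sum>k\<in>A. \<bar>x k\<bar>)\<^sup>2 \<le> real (card A) * (\<Sum>k\<in>A. (x k)\<^sup>2)"
    using Cauchy_Schwarz_ineq_sum[of "\<lambda>k. 1" "\<lambda>k. \<bar>x k\<bar>" A] by simp
  then have "((\<Sum>k\<in>A. \<bar>x k\<bar>)\<^sup>2)\<^sup>2 \<le> (real (card A) * (\<Sum>k\<in>A. (x k)\<^sup>2))\<^sup>2"
    by (rule power_mono) simp
  also have "\<dots> = (real (card A))\<^sup>2 * (\<Sum>k\<in>A. (x k)\<^sup>2)\<^sup>2" by (rule power_mult_distrib)
  also have "\<dots> \<le> (real (card A))\<^sup>2 * (real (card A) * (\<Sum>k\<in>A. x k ^ 4))"
    using Cauchy_Schwarz_ineq_sum[of "\<lambda>k. 1" "\<lambda>k. (x k)\<^sup>2" A]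
    by (intro mult_left_mono) (auto simp flip: power_mult)
  also have "\<dots> = real (card A) ^ 3 * (\<Sum>k\<in>A. x k ^ 4)" by (simp add: power3_eq_cube power2_eq_square)
  finally show ?thesis by (simp flip: power_mult)
qed

section \<open>Pathwise averages and unconditional fourth moments\<close>

lemma limsup_le_of_tendsto:
  fixes f g :: "nat \<Rightarrow> real"
  assumes "\<And>n. n \<ge> 1 \<Longrightarrow> f n \<le> g n" "g \<longlonglongrightarrow> l"
  shows "limsup (\<lambda>n. ereal (f n)) \<le> ereal l"
proof -
  have "limsup (\<lambda>n. ereal (f n)) \<le> limsup (\<lambda>n. ereal (g n))"
    using assms(1) by (intro Limsup_mono) (auto simp: eventually_sequentially)
  also have "\<dots> = ereal l"
    using assms(2) by (intro lim_imp_Limsup) auto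
  finally show ?thesis .
qed

text \<open>This is deterministic: along a fixed path \<open>G\<close> and \<open>e\<close> stand
  for the conditional means of the Lyapunov increments and penalties. Summing the drift inequality
  and discarding the \<open>h\<close> term bounds the average of \<open>p\<close>; replacing
  \<open>e\<close> by \<open>pmin\<close> bounds that of \<open>h\<close>, which also works for
  \<open>V = 0\<close>.\<close>

lemma drift_plus_penalty_averages:
  fixes L G p e h :: "nat \<Rightarrow> real" and V c pmin \<epsilon> :: real
  assumes L: "(\<lambda>n. (\<Sum>t<n. (L (Suc t) - L t) - G t) / real n) \<longlonglongrightarrow> 0"
    and p: "(\<lambda>n. (\<Sum>t<n. p t - e t) / real n) \<longlonglongrightarrow> 0"
    and drift: "\<And>t. G t + V * e t \<le> c - \<epsilon> * h t"
    and e_ge: "\<And>t. e t \<ge> pmin" and L_nonneg: "\<And>t. L t \<ge> 0" and h_nonneg: "\<And>t. h t \<ge> 0"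
    and V: "V \<ge> 0" and \<epsilon>: "\<epsilon> > 0"
  shows "V > 0 \<Longrightarrow> limsup (\<lambda>n. ereal ((1 / real n) * (\<Sum>t<n. p t))) \<le> ereal (c / V)"
    and "limsup (\<lambda>n. ereal ((1 / real n) * (\<Sum>t<n. h t))) \<le> ereal ((c - V * pmin) / \<epsilon>)"
proof -
  define \<alpha> where "\<alpha> n = (\<Sum>t<n. (L (Suc t) - L t) - G t) / real n" for n
  define \<beta> where "\<beta> n = (\<Sum>t<n. p t - e t) / real n" for n
  have \<alpha>0: "\<alpha> \<longlonglongrightarrow> 0" and \<beta>0: "\<beta> \<longlonglongrightarrow> 0"
    using L p by (simp_all add: \<alpha>_def[abs_def] \<beta>_def[abs_def])
  have L0: "(\<lambda>n. L 0 / real n) \<longlonglongrightarrow> 0" by (rule lim_const_over_n)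
  \<comment> \<open>The increments telescope, and discarding the nonnegative \<open>L n\<close>
    gives a lower bound for the sum of \<open>G\<close> up to the error
    \<open>real n * \<alpha> n\<close>.\<close>
  have G_sum: "(\<Sum>t<n. G t) \<ge> - (real n * \<alpha> n) - L 0" if "n \<ge> 1" for n
  proof -
    have "real n * \<alpha> n = (\<Sum>t<n. L (Suc t) - L t) - (\<Sum>t<n. G t)"
      using that by (simp add: \<alpha>_def sum_subtractf)
    also have "(\<Sum>t<n. L (Suc t) - L t) = L n - L 0" by (rule sum_lessThan_telescope)
    finally show ?thesis using L_nonneg[of n] by linarith
  qed
  show "limsup (\<lambda>n. ereal ((1 / real n) * (\<Sum>t<n. p t))) \<le> ereal (c / V)" if V: "V > 0"
  proof (rule limsup_le_of_tendsto)
    show "(\<lambda>n. \<beta> n + (\<alpha> n + L 0 / real n) / V + c / V) \<longlonglongrightarrow> c / V"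
      using tendsto_add[OF tendsto_add[OF \<beta>0 tendsto_divide[OF tendsto_add[OF \<alpha>0 L0] tendsto_const[of V]]] tendsto_const[of "c / V"]] V
      by simp
    show "(1 / real n) * (\<Sum>t<n. p t) \<le> \<beta> n + (\<alpha> n + L 0 / real n) / V + c / V" if n: "n \<ge> 1" for n
    proof -
      have "V * (\<Sum>t<n. e t) + (\<Sum>t<n. G t) = (\<Sum>t<n. G t + V * e t)"
        by (simp add: sum.distrib sum_distrib_left)
      also have "\<dots> \<le> (\<Sum>t<n. c)"
        using drift \<epsilon> h_nonneg by (intro sum_mono) (smt (verit) mult_nonneg_nonneg)
      finally have "V * (\<Sum>t<n. e t) \<le> real n * (\<alpha> n + L 0 / real n + c)"
        using G_sum[OF n] n by (simp add: algebra_simps)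
      moreover have "(\<Sum>t<n. p t) = real n * \<beta> n + (\<Sum>t<n. e t)"
        using n by (simp add: \<beta>_def sum_subtractf)
      ultimately have "V * (\<Sum>t<n. p t) \<le> real n * (V * \<beta> n + (\<alpha> n + L 0 / real n + c))"
        by (simp add: algebra_simps)
      then have "(\<Sum>t<n. p t) / real n \<le> (V * \<beta> n + (\<alpha> n + L 0 / real n + c)) / V"
        using V n by (simp add: pos_le_divide_eq pos_divide_le_eq mult.commute)
      then show ?thesis using V by (simp add: add_divide_distrib)
    qed
  qed
  show "limsup (\<lambda>n. ereal ((1 / real n) * (\<Sum>t<n. h t))) \<le> ereal ((c - V * pmin) / \<epsilon>)"
  proof (rule limsup_le_of_tendsto)
    show "(\<lambda>n. (\<alpha> n + L 0 / real n + (c - V * pmin)) / \<epsilon>) \<longlonglongrightarrow> (c - V * pmin) / \<epsilon>"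
      using tendsto_divide[OF tendsto_add[OF tendsto_add[OF \<alpha>0 L0] tendsto_const[of "c - V * pmin"]] tendsto_const[of \<epsilon>]] \<epsilon>
      by simp
    show "(1 / real n) * (\<Sum>t<n. h t) \<le> (\<alpha> n + L 0 / real n + (c - V * pmin)) / \<epsilon>" if n: "n \<ge> 1" for n
    proof -
      have "G t + \<epsilon> * h t \<le> c - V * pmin" for t
        using drift[of t] mult_left_mono[OF e_ge V, of t] by linarith
      then have "(\<Sum>t<n. G t + \<epsilon> * h t) \<le> (\<Sum>t<n. c - V * pmin)" by (intro sum_mono)
      then have "\<epsilon> * (\<Sum>t<n. h t) \<le> real n * (\<alpha> n + L 0 / real n + (c - V * pmin))"
        using G_sum[OF n] n by (simp add: sum.distrib sum_distrib_left algebra_simps)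
      then show ?thesis
        using \<epsilon> n by (simp add: pos_le_divide_eq pos_divide_le_eq mult.commute)
    qed
  qed
qed

text \<open>The extended nonnegative conditional expectation makes sense before integrability is
  known, so the tower property delivers integrability together with the bound.\<close>

lemma (in prob_space) moment_le_of_nn_cond_exp_le:
  assumes F: "subalgebra M F" and f[measurable]: "f \<in> borel_measurable M"
    and f_nonneg: "\<And>\<omega>. f \<omega> \<ge> 0" and D: "D \<ge> 0"
    and le: "AE \<omega> in M. nn_cond_exp M F (\<lambda>\<omega>. ennreal (f \<omega>)) \<omega> \<le> ennreal D"
  shows "integrable M f" and "(\<integral>\<omega>. f \<omega> \<partial>M) \<le> D"
proof -
  interpret finite_measure_subalgebra M F by unfold_locales (rule F)
  have "(\<integral>\<^sup>+\<omega>. ennreal (f \<omega>) \<partial>M) = (\<integral>\<^sup>+\<omega>. nn_cond_exp M F (\<lambda>\<omega>. ennreal (f \<omega>)) \<omega> \<partial>M)"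
    using nn_cond_exp_intg[of "\<lambda>_. 1" "\<lambda>\<omega>. ennreal (f \<omega>)"] by simp
  also have "\<dots> \<le> (\<integral>\<^sup>+\<omega>. ennreal D \<partial>M)" by (rule nn_integral_mono_AE[OF le])
  also have "\<dots> = ennreal D" by (simp add: emeasure_space_1)
  finally have nn: "(\<integral>\<^sup>+\<omega>. ennreal (f \<omega>) \<partial>M) \<le> ennreal D" .
  also have "\<dots> < \<infinity>" by simp
  finally show int: "integrable M f" using f_nonneg by (intro integrableI_nonneg) auto
  from nn show "(\<integral>\<omega>. f \<omega> \<partial>M) \<le> D"
    using D f_nonneg by (simp add: nn_integral_eq_integral[OF int])
qed

text \<open>Taking \<open>V \<ge> 0\<close> treats positive \<open>V\<close> and the closing case
  \<open>V = 0\<close> together. Finiteness of the initial state is built into the real-valued type.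
  The series in \<open>p_sum\<close> starts at index 0, where division by zero contributes 0, so it
  is the series from 1.\<close>

theorem theorem2:
  fixes M :: "'a measure"
    and Q :: "nat \<Rightarrow> nat \<Rightarrow> 'a \<Rightarrow> real"
    and p :: "nat \<Rightarrow> 'a \<Rightarrow> real"
    and K :: nat and w :: "nat \<Rightarrow> real"
    and pmin D B pstar V \<epsilon> :: real
  assumes M: "prob_space M"
    and Q_meas: "\<And>t k. Q t k \<in> borel_measurable M"
    and p_meas: "\<And>t. p t \<in> borel_measurable M"
    and w_pos: "\<And>k. k \<in> {1..K} \<Longrightarrow> w k > 0"
    and p_sq: "\<And>t. integrable M (\<lambda>\<omega>. (p t \<omega>)^2)"
    and p_sum: "summable (\<lambda>\<tau>. (\<integral>\<omega>. (p \<tau> \<omega>)^2 \<partial>M) / (real \<tau>)^2)"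
    and p_min: "\<And>t. AE \<omega> in M. real_cond_exp M (hist M Q p K t) (p t) \<omega> \<ge> pmin"
    and D_pos: "D > 0"
    and fourth: "\<And>t k. k \<in> {1..K} \<Longrightarrow>
           AE \<omega> in M. nn_cond_exp M (qsig M Q K t)
              (\<lambda>\<omega>. ennreal ((Q (Suc t) k \<omega> - Q t k \<omega>)^4)) \<omega> \<le> ennreal D"
    and V_nonneg: "V \<ge> 0"
    and eps_pos: "\<epsilon> > 0"
    and drift: "\<And>t. AE \<omega> in M.
           real_cond_exp M (hist M Q p K t)
              (\<lambda>\<omega>. lyap w K (\<lambda>k. Q (Suc t) k \<omega>) - lyap w K (\<lambda>k. Q t k \<omega>)) \<omega>
           + V * real_cond_exp M (hist M Q p K t) (p t) \<omega>
           \<le> B + V * pstar - \<epsilon> * (\<Sum>k\<in>{1..K}. \<bar>Q t k \<omega>\<bar>)"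
  shows "(V > 0 \<longrightarrow> (AE \<omega> in M.
            limsup (\<lambda>t. ereal ((1 / real t) * (\<Sum>\<tau><t. p \<tau> \<omega>))) \<le> ereal (pstar + B / V)))
       \<and> (AE \<omega> in M.
            limsup (\<lambda>t. ereal ((1 / real t) * (\<Sum>\<tau><t. \<Sum>k\<in>{1..K}. \<bar>Q \<tau> k \<omega>\<bar>)))
              \<le> ereal ((B + V * (pstar - pmin)) / \<epsilon>))
       \<and> (\<forall>k\<in>{1..K}. AE \<omega> in M. (\<lambda>t. Q t k \<omega> / real t) \<longlonglongrightarrow> 0)"
proof -
  interpret prob_space M by (rule M)
  define F where "F = hist M Q p K"
  define L where "L t \<omega> = lyap w K (\<lambda>k. Q t k \<omega>)" for t \<omega>
  define h where "h t \<omega> = (\<Sum>k\<in>{1..K}. \<bar>Q t k \<omega>\<bar>)" for t \<omega>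
  define S where "S t \<omega> = (\<Sum>k\<in>{1..K}. \<bar>Q (Suc t) k \<omega> - Q t k \<omega>\<bar>)" for t \<omega>
  define W where "W = (\<Sum>k\<in>{1..K}. w k)"
  define W' where "W' = 2 * (\<Sum>k\<in>{1..K}. 1 / w k)"
  define G where "G t = real_cond_exp M (F t) (\<lambda>\<omega>. L (Suc t) \<omega> - L t \<omega>)" for t
  define e where "e t = real_cond_exp M (F t) (p t)" for t
  note [measurable] = Q_meas p_meas
  have L_nonneg: "L t \<omega> \<ge> 0" for t \<omega> unfolding L_def by (rule lyap_nonneg[OF w_pos])
  have h_nonneg: "h t \<omega> \<ge> 0" and S_nonneg: "S t \<omega> \<ge> 0" for t \<omega>
    unfolding h_def S_def by (simp_all add: sum_nonneg)
  have W_nonneg: "W \<ge> 0" "W' \<ge> 0"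
    unfolding W_def W'_def using w_pos by (auto intro!: sum_nonneg mult_nonneg_nonneg simp: less_imp_le)
  have h_sq: "(h t \<omega>)\<^sup>2 \<le> W' * L t \<omega>" for t \<omega>
    unfolding h_def W'_def L_def by (rule sum_abs_square_le_lyap[OF w_pos])
  interpret filtered_prob_space M F
    by unfold_locales (auto simp: F_def intro: subalgebra_hist Q_meas p_meas hist_mono)
  \<comment> \<open>One constant \<open>W + W'\<close> serves both quadratic bounds:
    \<open>W\<close> for the increment and \<open>W'\<close> for the norm. Bounding the conditional
    penalty below by \<open>pmin\<close> turns the drift-plus-penalty constant into
    \<open>B + V * (pstar - pmin)\<close>. In the fourth moment, \<open>real K ^ 3\<close> comes
    from \<open>sum_abs_power4_le\<close> and one more factor from summing \<open>K\<close>
    moments.\<close>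
  interpret qd: quadratic_drift M F L h S "W + W'" "B + V * (pstar - pmin)" "real K ^ 4 * D" \<epsilon>
  proof
    fix t \<omega>
    have Q_hist: "Q t k \<in> borel_measurable (F t)" if "k \<in> {1..K}" for k
      unfolding F_def by (rule hist_measurable_Q) (use that in auto)
    show "L t \<in> borel_measurable (F t)"
      unfolding L_def[abs_def] lyap_def
      by (intro borel_measurable_times borel_measurable_const borel_measurable_sum borel_measurable_power Q_hist)
    show "h t \<in> borel_measurable (F t)"
      unfolding h_def[abs_def] by (intro borel_measurable_sum borel_measurable_abs Q_hist)
    show "S t \<in> borel_measurable M" unfolding S_def[abs_def] by measurable
    show "0 \<le> L t \<omega>" "0 \<le> h t \<omega>" "0 \<le> S t \<omega>" "0 \<le> W + W'" "0 < \<epsilon>"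
      using L_nonneg h_nonneg S_nonneg W_nonneg eps_pos by auto
    have "W' * L t \<omega> \<le> (W + W') * L t \<omega>"
      using L_nonneg[of t \<omega>] W_nonneg by (intro mult_right_mono) auto
    with h_sq[of t \<omega>] show "(h t \<omega>)\<^sup>2 \<le> (W + W') * L t \<omega>" by linarith
    have "\<bar>L (Suc t) \<omega> - L t \<omega>\<bar> \<le> W * (h t \<omega> * S t \<omega> + (S t \<omega>)\<^sup>2)"
      unfolding L_def W_def h_def S_def by (rule lyap_increment[OF w_pos])
    also have "\<dots> \<le> (W + W') * (h t \<omega> * S t \<omega> + (S t \<omega>)\<^sup>2)"
      using W_nonneg h_nonneg[of t \<omega>] S_nonneg[of t \<omega>] by (intro mult_right_mono) auto
    finally show "\<bar>L (Suc t) \<omega> - L t \<omega>\<bar> \<le> (W + W') * (h t \<omega> * S t \<omega> + (S t \<omega>)\<^sup>2)" .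
    have fourth': "integrable M (\<lambda>\<omega>. (Q (Suc t) k \<omega> - Q t k \<omega>) ^ 4)"
      "(\<integral>\<omega>. (Q (Suc t) k \<omega> - Q t k \<omega>) ^ 4 \<partial>M) \<le> D" if "k \<in> {1..K}" for k
      using that D_pos
      by (intro moment_le_of_nn_cond_exp_le[OF subalgebra_qsig[of Q M K t] _ _ _ fourth[of k t]]; simp)+
    let ?R = "\<lambda>\<omega>. real K ^ 3 * (\<Sum>k\<in>{1..K}. (Q (Suc t) k \<omega> - Q t k \<omega>) ^ 4)"
    have R_int: "integrable M ?R"
      by (intro integrable_mult_right Bochner_Integration.integrable_sum fourth')
    have S4_le: "S t \<omega> ^ 4 \<le> ?R \<omega>" for \<omega>
      unfolding S_def using sum_abs_power4_le[of "\<lambda>k. Q (Suc t) k \<omega> - Q t k \<omega>" "{1..K}"] by simp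
    show S4_int: "integrable M (\<lambda>\<omega>. S t \<omega> ^ 4)"
    proof (rule Bochner_Integration.integrable_bound[OF R_int])
      show "AE \<omega> in M. norm (S t \<omega> ^ 4) \<le> norm (?R \<omega>)"
        using order_trans[OF S4_le abs_ge_self] by (intro AE_I2) simp
    qed (simp add: S_def[abs_def])
    have "(\<integral>\<omega>. S t \<omega> ^ 4 \<partial>M) \<le> (\<integral>\<omega>. ?R \<omega> \<partial>M)" by (intro integral_mono S4_int R_int S4_le)
    also have "\<dots> = real K ^ 3 * (\<Sum>k\<in>{1..K}. \<integral>\<omega>. (Q (Suc t) k \<omega> - Q t k \<omega>) ^ 4 \<partial>M)"
      using fourth'(1) by (subst integral_mult_right_zero, subst Bochner_Integration.integral_sum) auto
    also have "\<dots> \<le> real K ^ 3 * (\<Sum>k\<in>{1..K}. D)"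
      by (intro mult_left_mono sum_mono fourth') auto
    also have "\<dots> = real K ^ 4 * D" by (simp add: eval_nat_numeral)
    finally show "(\<integral>\<omega>. S t \<omega> ^ 4 \<partial>M) \<le> real K ^ 4 * D" .
    show "AE \<omega> in M. real_cond_exp M (F t) (\<lambda>\<omega>. L (Suc t) \<omega> - L t \<omega>) \<omega> \<le> B + V * (pstar - pmin) - \<epsilon> * h t \<omega>"
      using drift[of t] p_min[of t]
    proof eventually_elim
      case (elim \<omega>)
      then show ?case
        using mult_left_mono[OF elim(2) V_nonneg] unfolding L_def h_def F_def
        by (simp add: right_diff_distrib)
    qed
  qed
  have p_SLLN: "AE \<omega> in M. (\<lambda>n. (\<Sum>t<n. p t \<omega> - e t \<omega>) / real n) \<longlonglongrightarrow> 0"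
    unfolding e_def
  proof (rule martingale_difference_SLLN[OF _ p_sq])
    show "p t \<in> borel_measurable (F (Suc t))" for t
      unfolding F_def by (rule hist_measurable_p) simp
    show "summable (\<lambda>t. (\<integral>\<omega>. (p t \<omega>)\<^sup>2 \<partial>M) / (real (Suc t))\<^sup>2)"
    \<comment> \<open>The comparison starts at 1, since the dominating term at index 0 is 0 by
      division by zero.\<close>
    proof (rule summable_comparison_test'[OF p_sum, of 1])
      show "norm ((\<integral>\<omega>. (p t \<omega>)\<^sup>2 \<partial>M) / (real (Suc t))\<^sup>2) \<le> (\<integral>\<omega>. (p t \<omega>)\<^sup>2 \<partial>M) / (real t)\<^sup>2"
        if "t \<ge> 1" for t
      proof -
        have "(\<integral>\<omega>. (p t \<omega>)\<^sup>2 \<partial>M) / (real (Suc t))\<^sup>2 \<le> (\<integral>\<omega>. (p t \<omega>)\<^sup>2 \<partial>M) / (real t)\<^sup>2"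
          using that by (intro divide_left_mono power_mono mult_pos_pos) auto
        then show ?thesis by simp
      qed
    qed
  qed
  have drift_all: "AE \<omega> in M. \<forall>t. G t \<omega> + V * e t \<omega> \<le> B + V * pstar - \<epsilon> * h t \<omega>"
    unfolding G_def e_def h_def F_def L_def by (subst AE_all_countable) (intro allI drift)
  have e_all: "AE \<omega> in M. \<forall>t. e t \<omega> \<ge> pmin"
    unfolding e_def F_def by (subst AE_all_countable) (intro allI p_min)
  have L_SLLN: "AE \<omega> in M. (\<lambda>n. (\<Sum>t<n. (L (Suc t) \<omega> - L t \<omega>) - G t \<omega>) / real n) \<longlonglongrightarrow> 0"
    unfolding G_def by (rule qd.increments_SLLN)
  have "AE \<omega> in M. limsup (\<lambda>n. ereal ((1 / real n) * (\<Sum>t<n. p t \<omega>))) \<le> ereal (pstar + B / V)" if V: "V > 0"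
    using L_SLLN p_SLLN drift_all e_all
  proof eventually_elim
    case (elim \<omega>)
    have "limsup (\<lambda>n. ereal ((1 / real n) * (\<Sum>t<n. p t \<omega>))) \<le> ereal ((B + V * pstar) / V)"
      using elim L_nonneg h_nonneg V_nonneg eps_pos V
      by (intro drift_plus_penalty_averages(1)[where G = "\<lambda>t. G t \<omega>" and L = "\<lambda>t. L t \<omega>" and e = "\<lambda>t. e t \<omega>"
          and h = "\<lambda>t. h t \<omega>" and pmin = pmin and \<epsilon> = \<epsilon>]) auto
    also have "(B + V * pstar) / V = pstar + B / V" using V by (simp add: field_simps)
    finally show ?case .
  qed
  moreover have "AE \<omega> in M. limsup (\<lambda>n. ereal ((1 / real n) * (\<Sum>t<n. h t \<omega>))) \<le> ereal ((B + V * (pstar - pmin)) / \<epsilon>)"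
    using L_SLLN p_SLLN drift_all e_all
  proof eventually_elim
    case (elim \<omega>)
    have "limsup (\<lambda>n. ereal ((1 / real n) * (\<Sum>t<n. h t \<omega>))) \<le> ereal ((B + V * pstar - V * pmin) / \<epsilon>)"
      using elim L_nonneg h_nonneg V_nonneg eps_pos
      by (intro drift_plus_penalty_averages(2)[where G = "\<lambda>t. G t \<omega>" and L = "\<lambda>t. L t \<omega>" and e = "\<lambda>t. e t \<omega>"
          and p = "\<lambda>t. p t \<omega>"]) auto
    then show ?case by (simp add: algebra_simps)
  qed
  moreover have "AE \<omega> in M. (\<lambda>t. Q t k \<omega> / real t) \<longlonglongrightarrow> 0" if k: "k \<in> {1..K}" for k
    using qd.L_div_square_tendsto_0
  proof eventually_elim
    case (elim \<omega>)
    \<comment> \<open>Each component is dominated by \<open>h\<close>, whose square is at most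
      \<open>W' * L t \<omega>\<close>; so the quadratic decay of \<open>L\<close> yields sublinear
      growth of the component.\<close>
    have "(\<lambda>t. sqrt (W' * (L t \<omega> / (real t)\<^sup>2))) \<longlonglongrightarrow> sqrt 0"
      by (intro tendsto_real_sqrt tendsto_mult_right_zero elim)
    then have lim: "(\<lambda>t. sqrt (W' * (L t \<omega> / (real t)\<^sup>2))) \<longlonglongrightarrow> 0" by simp
    have "norm (Q t k \<omega> / real t) \<le> sqrt (W' * (L t \<omega> / (real t)\<^sup>2))" for t
    proof (rule real_le_rsqrt)
      have "\<bar>Q t k \<omega>\<bar> \<le> h t \<omega>"
        unfolding h_def using member_le_sum[OF k, of "\<lambda>k. \<bar>Q t k \<omega>\<bar>"] by simp
      then have "\<bar>Q t k \<omega>\<bar>\<^sup>2 \<le> (h t \<omega>)\<^sup>2" by (rule power_mono) simp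
      with h_sq[of t \<omega>] have "(Q t k \<omega>)\<^sup>2 \<le> W' * L t \<omega>" by simp
      then show "(norm (Q t k \<omega> / real t))\<^sup>2 \<le> W' * (L t \<omega> / (real t)\<^sup>2)"
        by (simp add: power_divide divide_right_mono)
    qed
    then show ?case by (intro Lim_null_comparison[OF _ lim] always_eventually allI)
  qed
  ultimately show ?thesis unfolding h_def by blast
qed

end
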